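(* Let $R$ be a finite commutative ring with unity $1\ne 0$, decomposed as $R\cong R_1\times\cdots\times R_s$ ($s\ge1$) with each $R_i$ a finite local ring with maximal ideal $M_i$, ordered so that $|R_1|/|M_1|\geq\cdots\geq|R_s|/|M_s|$, and suppose $|R_i|/|M_i|\equiv 1\pmod 4$ for all $i\in\{1,\ldots,s\}$. Then the quadratic unitary Cayley graph $\mathcal{G}_R$ is periodic if and only if $s=1$ and $R_1/M_1\cong\mathbb{Z}_5$.
   Context: $R^\times$ is the group of units of $R$; $Q_R=\{u^2:u\in R^\times\}$ and $T_R=Q_R\cup(-Q_R)$. The quadratic unitary Cayley graph $\mathcal{G}_R=\operatorname{Cay}(R,T_R)$ has vertex set $R$, with distinct $u,v$ adjacent iff $u-v\in T_R$. Grover walk on a finite simple graph $G$ without isolated vertices: arcs $\mathcal{A}(G)=\{(u,v),(v,u):uv\in E(G)\}$, for $a=(u,v)$ put $t(a)=v$, $a^{-1}=(v,u)$; boundary matrix $N_{ua}=\frac{1}{\sqrt{\deg u}}\delta_{u,t(a)}$; shift matrix $S_{ab}=\delta_{a,b^{-1}}$; time evolution matrix $U=S(2N^*N-I)$. $G$ is periodic if $U^\tau=I$ for some positive integer $\tau$. *)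

theory Defs
  imports
    Complex_Main
    "HOL-Number_Theory.Cong"
    "HOL-Algebra.Chinese_Remainder"
    "HOL-Algebra.IntRing"
    "Graph_Theory.Graph_Theory"
begin

definition local_cring :: "('a, 'm) ring_scheme \<Rightarrow> bool" where
  "local_cring R \<longleftrightarrow> cring R \<and> (\<exists>!M. maximalideal M R)"

definition unit_squares :: "('a, 'm) ring_scheme \<Rightarrow> 'a set" where
  "unit_squares R = {u [^]\<^bsub>R\<^esub> (2::nat) | u. u \<in> Units R}"

definition pm_unit_squares :: "('a, 'm) ring_scheme \<Rightarrow> 'a set" where
  "pm_unit_squares R = unit_squares R \<union> (\<lambda>x. \<ominus>\<^bsub>R\<^esub> x) ` unit_squares R"

text \<open>
  A simple graph is represented, as in the Graph Theory library, by the symmetric loop-free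
  digraph containing both orientations of every edge; its set of arcs is therefore exactly the
  arc set on which the Grover walk lives.
\<close>

definition cayley_graph :: "('a, 'm) ring_scheme \<Rightarrow> 'a set \<Rightarrow> 'a pair_pre_digraph" where
  "cayley_graph R T =
     \<lparr> pverts = carrier R,
       parcs = {(u, v). u \<in> carrier R \<and> v \<in> carrier R \<and> u \<noteq> v \<and> u \<ominus>\<^bsub>R\<^esub> v \<in> T} \<rparr>"

definition quadratic_unitary_cayley_graph :: "('a, 'm) ring_scheme \<Rightarrow> 'a pair_pre_digraph" where
  "quadratic_unitary_cayley_graph R = cayley_graph R (pm_unit_squares R)"

text \<open>
  A complex matrix with rows indexed by a finite set \<open>I\<close> and columns by a finite set \<open>J\<close> is a
  function of two arguments, of which only the values on \<open>I \<times> J\<close> are meaningful.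
\<close>

type_synonym ('i, 'j) cmatrix = "'i \<Rightarrow> 'j \<Rightarrow> complex"

definition mtimes :: "'j set \<Rightarrow> ('i, 'j) cmatrix \<Rightarrow> ('j, 'k) cmatrix \<Rightarrow> ('i, 'k) cmatrix" where
  "mtimes J A B = (\<lambda>i k. \<Sum>j\<in>J. A i j * B j k)"

definition madjoint :: "('i, 'j) cmatrix \<Rightarrow> ('j, 'i) cmatrix" where
  "madjoint A = (\<lambda>j i. cnj (A i j))"

definition mident :: "('i, 'i) cmatrix" where
  "mident = (\<lambda>i j. if i = j then 1 else 0)"

primrec mpower :: "'i set \<Rightarrow> ('i, 'i) cmatrix \<Rightarrow> nat \<Rightarrow> ('i, 'i) cmatrix" where
  "mpower I A 0 = mident"
| "mpower I A (Suc n) = mtimes I A (mpower I A n)"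

text \<open>
  These notions are meant for finite simple graphs without isolated vertices, that is,
  for \<open>pair_graph G\<close> with positive degrees. The terminus of an arc \<open>a\<close> is \<open>snd a\<close> and its
  inverse is \<open>prod.swap a\<close>.
\<close>

definition boundary_matrix :: "'v pair_pre_digraph \<Rightarrow> ('v, 'v \<times> 'v) cmatrix" where
  "boundary_matrix G = (\<lambda>u a.
     complex_of_real (1 / sqrt (real (out_degree (with_proj G) u))) * (if u = snd a then 1 else 0))"

definition shift_matrix :: "('v \<times> 'v, 'v \<times> 'v) cmatrix" where
  "shift_matrix = (\<lambda>a b. if a = prod.swap b then 1 else 0)"

definition grover_matrix :: "'v pair_pre_digraph \<Rightarrow> ('v \<times> 'v, 'v \<times> 'v) cmatrix" where
  "grover_matrix G =
     (let N = boundary_matrix G in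
      mtimes (parcs G) shift_matrix
        (\<lambda>a b. 2 * mtimes (pverts G) (madjoint N) N a b - mident a b))"

definition grover_periodic :: "'v pair_pre_digraph \<Rightarrow> bool" where
  "grover_periodic G \<longleftrightarrow>
     (\<exists>\<tau>::nat. \<tau> > 0 \<and>
        (\<forall>a\<in>parcs G. \<forall>b\<in>parcs G. mpower (parcs G) (grover_matrix G) \<tau> a b = mident a b))"

lemma (in cring) pm_unit_squares_closed: "pm_unit_squares R \<subseteq> carrier R"
  by (auto simp: pm_unit_squares_def unit_squares_def)

lemma (in cring) pm_unit_squares_uminus:
  assumes "x \<in> pm_unit_squares R" shows "\<ominus> x \<in> pm_unit_squares R"
  using assms by (auto simp: pm_unit_squares_def unit_squares_def image_iff)
    (metis Units_closed minus_minus nat_pow_closed)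

lemma (in cring) one_pm_unit_squares: "\<one> \<in> pm_unit_squares R"
  by (auto simp: pm_unit_squares_def unit_squares_def intro!: exI[of _ \<one>])

lemma (in cring) pair_graph_quadratic_unitary_cayley_graph:
  assumes "finite (carrier R)"
  shows "pair_graph (quadratic_unitary_cayley_graph R)"
proof -
  let ?G = "quadratic_unitary_cayley_graph R"
  have fin: "finite (parcs ?G)"
    by (rule finite_subset[of _ "carrier R \<times> carrier R"])
       (auto simp: quadratic_unitary_cayley_graph_def cayley_graph_def assms)
  have "v \<ominus> u \<in> pm_unit_squares R"
    if "u \<in> carrier R" "v \<in> carrier R" "u \<ominus> v \<in> pm_unit_squares R" for u v
  proof -
    have "v \<ominus> u = \<ominus> (u \<ominus> v)" using that by (simp add: minus_eq minus_add a_comm)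
    then show ?thesis using pm_unit_squares_uminus that(3) by simp
  qed
  then have "sym (parcs ?G)"
    by (auto simp: sym_def quadratic_unitary_cayley_graph_def cayley_graph_def)
  then show ?thesis
    using fin assms
    by unfold_locales
       (auto simp: symmetric_def quadratic_unitary_cayley_graph_def cayley_graph_def)
qed

lemma (in cring) quadratic_unitary_cayley_graph_no_isolated:
  assumes "finite (carrier R)" "\<one> \<noteq> \<zero>" "u \<in> carrier R"
  shows "out_degree (with_proj (quadratic_unitary_cayley_graph R)) u > 0"
proof -
  let ?G = "quadratic_unitary_cayley_graph R"
  interpret G: pair_graph ?G
    by (rule pair_graph_quadratic_unitary_cayley_graph[OF assms(1)])
  have 1: "u \<ominus> (u \<ominus> \<one>) = \<one>"
    using assms(3) by algebra
  then have "u \<noteq> u \<ominus> \<one>"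
    using assms(2,3) by (metis r_neg minus_eq)
  then have "(u, u \<ominus> \<one>) \<in> out_arcs (with_proj ?G) u"
    using assms(3) 1 one_pm_unit_squares
    by (auto simp: out_arcs_def quadratic_unitary_cayley_graph_def cayley_graph_def)
  moreover have "finite (out_arcs (with_proj ?G) u)"
    by (rule finite_subset[OF _ G.pair_finite_arcs]) (auto simp: out_arcs_def)
  ultimately show ?thesis
    unfolding out_degree_def card_gt_0_iff by blast
qed

end

theory Submission
  imports Defs "HOL-Algebra.Multiplicative_Group" "HOL-Library.Indicator_Function"
begin

text \<open>
  For a \<open>k\<close>-regular graph with adjacency operator \<open>A\<close>, the vertex sums \<open>F\<^sub>n\<close> of the \<open>n\<close>-th iterate of
  the walk satisfy \<open>F\<^sub>n\<^sub>+\<^sub>2 = (2 / k) A F\<^sub>n\<^sub>+\<^sub>1 - F\<^sub>n\<close>. Hence periodicity with period \<open>\<tau>\<close> forces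
  \<open>T\<^sub>\<tau>(\<mu>) = 1\<close> for every eigenvalue \<open>\<mu>\<close> of \<open>A / k\<close>, where \<open>T\<^sub>\<tau>\<close> is the Chebyshev polynomial.

  Under the hypothesis \<open>-1\<close> is a square, so the graph is the tensor product of those of the local
  factors and eigenvalues of \<open>A / k\<close> multiply. In a local ring with residue field of order \<open>q = 4c + 1\<close>
  the quadratic character shows that the graph is a blow-up of a strongly regular graph, whose
  normalised eigenvalues satisfy \<open>2\<mu> = 1 / y\<close> with \<open>y\<^sup>2 = y + c\<close>. Expanding \<open>y\<^sup>\<tau> 2T\<^sub>\<tau>(\<mu>)\<close> in \<open>\<int>[y]\<close> and
  reducing modulo \<open>c\<close> leaves \<open>c = 1\<close>. Two factors with \<open>c = 1\<close> would yield the eigenvalue \<open>-1/4\<close>, and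
  \<open>2\<mu> = -1/2\<close> is not an algebraic integer. Conversely, for one factor with \<open>c = 1\<close> the operator \<open>A\<close>
  satisfies a cubic relation that makes the recurrence, and then the walk, periodic with period 20.
\<close>

section \<open>The Grover walk on a regular graph\<close>

text \<open>The values \<open>2 T\<^sub>n(x / 2)\<close>, which are monic integer polynomials in \<open>x\<close> for \<open>n > 0\<close>.\<close>
fun dilated_chebyshev :: "real \<Rightarrow> nat \<Rightarrow> real" where
  "dilated_chebyshev x 0 = 2"
| "dilated_chebyshev x (Suc 0) = x"
| "dilated_chebyshev x (Suc (Suc n)) = x * dilated_chebyshev x (Suc n) - dilated_chebyshev x n"

locale regular_pair_graph = pair_graph G for G :: "'v pair_pre_digraph" +
  fixes k :: nat
  assumes card_neighbours: "u \<in> pverts G \<Longrightarrow> card {w. (u, w) \<in> parcs G} = k"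
begin

definition inflow :: "('v \<times> 'v \<Rightarrow> real) \<Rightarrow> 'v \<Rightarrow> real" where
  "inflow g u = (\<Sum>w | (w, u) \<in> parcs G. g (w, u))"

text \<open>This is \<open>grover_matrix\<close> acting on arc functions: the shift reads the
  reflected function at the reversed arc \<open>(v, u)\<close>, whose terminus is \<open>u\<close>.
  Real functions suffice because the matrix has real entries.\<close>

definition grover_step :: "('v \<times> 'v \<Rightarrow> real) \<Rightarrow> 'v \<times> 'v \<Rightarrow> real" where
  "grover_step g = (\<lambda>(u, v). 2 / k * inflow g u - g (v, u))"

definition neighbour_sum :: "('v \<Rightarrow> real) \<Rightarrow> 'v \<Rightarrow> real" where
  "neighbour_sum f u = (\<Sum>w | (w, u) \<in> parcs G. f w)"

lemma arc_sym: "(u, v) \<in> parcs G \<longleftrightarrow> (v, u) \<in> parcs G"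
  using arcs_symmetric by blast

lemma arc_verts: "(u, v) \<in> parcs G \<Longrightarrow> u \<in> pverts G \<and> v \<in> pverts G"
  using in_arcsD1 in_arcsD2 by auto

lemma out_degree_eq: "u \<in> pverts G \<Longrightarrow> out_degree (with_proj G) u = k"
proof -
  assume u: "u \<in> pverts G"
  have "out_arcs (with_proj G) u = Pair u ` {w. (u, w) \<in> parcs G}"
    by (auto simp: out_arcs_def)
  then show ?thesis
    using card_neighbours[OF u] by (simp add: out_degree_def card_image inj_on_def)
qed

lemma grover_matrix_entry:
  assumes a: "a \<in> parcs G" and b: "b \<in> parcs G"
  shows "grover_matrix G a b =
    of_real ((2 / k) * (if snd b = fst a then 1 else 0) - (if b = prod.swap a then 1 else 0))"
proof -
  define X :: "('v \<times> 'v, 'v \<times> 'v) cmatrix" where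
    "X = (\<lambda>a b. 2 * mtimes (pverts G) (madjoint (boundary_matrix G)) (boundary_matrix G) a b - mident a b)"
  let ?a = "prod.swap a"
  have sa: "?a \<in> parcs G" using a arc_sym by (cases a) auto
  have vb: "snd b \<in> pverts G" using b arc_verts by (cases b) auto
  have "grover_matrix G a b = (\<Sum>c\<in>parcs G. (if c = ?a then 1 else 0) * X c b)"
    unfolding grover_matrix_def Let_def X_def mtimes_def shift_matrix_def
    by (intro sum.cong) (auto simp: prod_eq_iff)
  also have "\<dots> = X ?a b"
    using sa by (simp add: if_distrib[of "\<lambda>x. x * _"] cong: if_cong)
  \<comment> \<open>Only a common terminus of the two arcs contributes, and the two factors
    \<open>1 / sqrt k\<close> multiply to \<open>1 / k\<close>.\<close>
  also have "mtimes (pverts G) (madjoint (boundary_matrix G)) (boundary_matrix G) ?a b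
     = (\<Sum>u\<in>pverts G. if u = snd b then (if snd b = fst a then of_real (1 / k) else 0) else 0)"
    unfolding mtimes_def madjoint_def boundary_matrix_def
    by (intro sum.cong) (auto simp: out_degree_eq simp flip: of_real_mult)
  then have "X ?a b = of_real ((2 / k) * (if snd b = fst a then 1 else 0) - (if b = prod.swap a then 1 else 0))"
    using vb by (auto simp: X_def mident_def)
  finally show ?thesis .
qed

lemma grover_step_pair: "grover_step g (u, v) = 2 / k * inflow g u - g (v, u)"
  by (simp add: grover_step_def)

lemma grover_matrix_apply:
  assumes a: "a \<in> parcs G"
  shows "(\<Sum>b\<in>parcs G. grover_matrix G a b * of_real (g b)) = of_real (grover_step g a)"
proof -
  obtain u v where uv: "a = (u, v)" by (cases a)
  have vu: "(v, u) \<in> parcs G" using a uv arc_sym by simp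
  have "(\<Sum>b\<in>parcs G. grover_matrix G a b * of_real (g b)) = of_real (\<Sum>b\<in>parcs G.
     (2 / k) * (if snd b = u then g b else 0) - (if b = (v, u) then g b else 0))"
    unfolding of_real_sum by (intro sum.cong) (auto simp: grover_matrix_entry[OF a, unfolded uv] uv left_diff_distrib)
  also have "(\<Sum>b\<in>parcs G. (2 / k) * (if snd b = u then g b else 0) - (if b = (v, u) then g b else 0))
     = 2 / k * (\<Sum>b\<in>parcs G. if snd b = u then g b else 0) - g (v, u)"
    using vu by (simp add: sum_subtractf sum_distrib_left)
  also have "(\<Sum>b\<in>parcs G. if snd b = u then g b else 0) = (\<Sum>b\<in>{b\<in>parcs G. snd b = u}. g b)"
    by (simp add: sum.inter_filter)
  also have "\<dots> = inflow g u"
    unfolding inflow_def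
    by (rule sum.reindex_bij_witness[of _ "\<lambda>w. (w, u)" fst]) auto
  finally show ?thesis by (simp add: uv grover_step_pair)
qed

lemma mpower_grover_apply:
  "a \<in> parcs G \<Longrightarrow> (\<Sum>b\<in>parcs G. mpower (parcs G) (grover_matrix G) n a b * of_real (g b))
     = of_real ((grover_step ^^ n) g a)"
proof (induction n arbitrary: a)
  case 0
  then show ?case by (simp add: mident_def if_distrib[of "\<lambda>x. x * _"] cong: if_cong)
next
  case (Suc n)
  let ?M = "mpower (parcs G) (grover_matrix G) n"
  have "(\<Sum>b\<in>parcs G. mpower (parcs G) (grover_matrix G) (Suc n) a b * of_real (g b))
    = (\<Sum>b\<in>parcs G. \<Sum>c\<in>parcs G. grover_matrix G a c * (?M c b * of_real (g b)))"
    by (simp add: mtimes_def sum_distrib_right mult.assoc)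
  also have "\<dots> = (\<Sum>c\<in>parcs G. grover_matrix G a c * of_real ((grover_step ^^ n) g c))"
    by (subst sum.swap) (simp add: Suc.IH flip: sum_distrib_left)
  finally show ?case using grover_matrix_apply[OF Suc.prems] by simp
qed

text \<open>A real matrix is determined by its action on real arc functions, and indicators of
  single arcs recover its entries. From here on only iterates of \<open>grover_step\<close>
  occur.\<close>

lemma grover_periodic_iff:
  "grover_periodic G \<longleftrightarrow> (\<exists>\<tau>>0. \<forall>g. \<forall>a\<in>parcs G. (grover_step ^^ \<tau>) g a = g a)"
proof -
  have "(\<forall>a\<in>parcs G. \<forall>b\<in>parcs G. mpower (parcs G) (grover_matrix G) \<tau> a b = mident a b)
    \<longleftrightarrow> (\<forall>g. \<forall>a\<in>parcs G. (grover_step ^^ \<tau>) g a = g a)" (is "?L \<longleftrightarrow> ?R") for \<tau>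
  proof
    assume L: ?L
    show ?R
    proof safe
      fix g u v assume a: "(u, v) \<in> parcs G"
      have "complex_of_real ((grover_step ^^ \<tau>) g (u, v)) = (\<Sum>b\<in>parcs G. mident (u, v) b * of_real (g b))"
        using L a mpower_grover_apply[OF a, where n = \<tau> and g = g] by (metis (no_types, lifting) sum.cong)
      also have "\<dots> = of_real (g (u, v))"
        using a by (simp add: mident_def if_distrib[of "\<lambda>x. x * _"] cong: if_cong)
      finally show "(grover_step ^^ \<tau>) g (u, v) = g (u, v)" by simp
    qed
  next
    assume R: ?R
    show ?L
    proof (intro ballI)
      fix a b assume a: "a \<in> parcs G" and b: "b \<in> parcs G"
      let ?g = "\<lambda>c. if c = b then 1 else 0 :: real"
      have "mpower (parcs G) (grover_matrix G) \<tau> a b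
        = (\<Sum>c\<in>parcs G. mpower (parcs G) (grover_matrix G) \<tau> a c * of_real (?g c))"
        using b by (simp add: if_distrib[of of_real] if_distrib[of "\<lambda>x. _ * x"] cong: if_cong)
      also have "\<dots> = of_real (?g a)"
        using R a by (subst mpower_grover_apply) auto
      finally show "mpower (parcs G) (grover_matrix G) \<tau> a b = mident a b"
        by (simp add: mident_def)
    qed
  qed
  then show ?thesis unfolding grover_periodic_def by blast
qed

section \<open>Vertex sums and the three-term recurrence\<close>

lemma finite_neighbours: "finite {w. (w, u) \<in> parcs G}"
  by (rule finite_subset[of _ "fst ` parcs G"]) (auto simp: image_iff, metis fst_conv)

lemma card_in_neighbours: "u \<in> pverts G \<Longrightarrow> card {w. (w, u) \<in> parcs G} = k"
  by (subst arc_sym) (rule card_neighbours)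

text \<open>The reflected part of the outer step sums \<open>grover_step g\<close> over the arcs
  leaving \<open>u\<close>. Regularity collapses that sum: \<open>k\<close> copies of
  \<open>2 / k * inflow g u\<close>, less one \<open>inflow g u\<close>, leave
  \<open>inflow g u\<close>.\<close>

lemma inflow_grover_step2:
  assumes u: "u \<in> pverts G" and k: "k > 0"
  shows "inflow (grover_step (grover_step g)) u
    = 2 / k * neighbour_sum (inflow (grover_step g)) u - inflow g u"
proof -
  have "inflow (grover_step (grover_step g)) u
    = 2 / k * neighbour_sum (inflow (grover_step g)) u - (\<Sum>w | (w, u) \<in> parcs G. grover_step g (u, w))"
    by (simp only: inflow_def[of "grover_step (grover_step g)"] grover_step_pair[of "grover_step g"]
        neighbour_sum_def sum_subtractf sum_distrib_left)
  also have "(\<Sum>w | (w, u) \<in> parcs G. grover_step g (u, w)) = inflow g u"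
    using k by (simp add: grover_step_pair sum_subtractf card_in_neighbours[OF u] inflow_def[of g])
  finally show ?thesis .
qed

text \<open>Two reversals bring an arc back to itself, so over two steps its value changes only by
  vertex sums. This later lifts periodicity from vertex sums to the walk.\<close>

lemma grover_step2:
  "grover_step (grover_step g) (u, v) = 2 / k * (inflow (grover_step g) u - inflow g v) + g (u, v)"
  by (simp add: grover_step_pair algebra_simps)


text \<open>The start function depends only on the terminus of an arc. Its vertex sums at times 0
  and 1 are \<open>k * f\<close> and \<open>k * c * f\<close>, the initial data of the Chebyshev
  recurrence, and the eigenvalue equation turns \<open>inflow_grover_step2\<close> into that
  recurrence.\<close>

lemma inflow_funpow_eigenvector:
  fixes f :: "'v \<Rightarrow> real" and c :: real
  assumes k: "k > 0" and ev: "\<And>u. u \<in> pverts G \<Longrightarrow> neighbour_sum f u = k * c * f u"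
    and u: "u \<in> pverts G"
  shows "2 * inflow ((grover_step ^^ n) (\<lambda>(w, v). f v)) u = k * dilated_chebyshev (2 * c) n * f u"
  using u
proof (induction n arbitrary: u rule: induct_nat_012)
  case 0
  then show ?case by (simp add: inflow_def card_in_neighbours)
next
  case 1
  let ?g = "\<lambda>(w, v). f v"
  have "inflow (grover_step ?g) u = (\<Sum>w | (w, u) \<in> parcs G. f w)"
    unfolding inflow_def[of "grover_step ?g"]
  proof (intro sum.cong refl)
    fix w assume "w \<in> {w. (w, u) \<in> parcs G}"
    then have "inflow ?g w = k * f w"
      using arc_verts by (auto simp: inflow_def card_in_neighbours)
    then show "grover_step ?g (w, u) = f w"
      using k by (simp add: grover_step_pair)
  qed
  then show ?case using ev[OF 1] by (simp add: neighbour_sum_def)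
next
  case (ge2 n)
  let ?F = "\<lambda>n. inflow ((grover_step ^^ n) (\<lambda>(w, v). f v))"
  have "2 * neighbour_sum (?F (Suc n)) u = neighbour_sum (\<lambda>w. k * dilated_chebyshev (2 * c) (Suc n) * f w) u"
    unfolding neighbour_sum_def sum_distrib_left
    by (intro sum.cong refl ge2.IH(2)) (auto dest: arc_verts)
  also have "\<dots> = k * dilated_chebyshev (2 * c) (Suc n) * (k * c * f u)"
    using ev[OF ge2.prems] by (simp add: neighbour_sum_def flip: sum_distrib_left)
  finally have "2 * (2 / k * neighbour_sum (?F (Suc n)) u - ?F n u)
     = k * dilated_chebyshev (2 * c) (Suc (Suc n)) * f u"
    using ge2.IH(1)[OF ge2.prems] k by (simp add: field_simps)
  then show ?case
    using inflow_grover_step2[OF ge2.prems k] by simp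
qed

text \<open>A period fixes the vertex sums, so the Chebyshev factor at time \<open>\<tau>\<close>
  equals its value 2 at time 0. One \<open>\<tau>\<close> serves all eigenvalues, which allows two
  of them to be compared later.\<close>

lemma grover_periodic_imp_chebyshev:
  assumes "grover_periodic G" and k: "k > 0"
  obtains \<tau> where "\<tau> > 0"
    "\<And>c :: real. \<And>f :: 'v \<Rightarrow> real. \<And>u. (\<And>v. v \<in> pverts G \<Longrightarrow> neighbour_sum f v = k * c * f v) \<Longrightarrow> u \<in> pverts G \<Longrightarrow> f u \<noteq> 0
       \<Longrightarrow> dilated_chebyshev (2 * c) \<tau> = 2"
proof -
  obtain \<tau> where \<tau>: "\<tau> > 0" and per: "\<And>g a. a \<in> parcs G \<Longrightarrow> (grover_step ^^ \<tau>) g a = g a"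
    using assms(1) unfolding grover_periodic_iff by blast
  have "dilated_chebyshev (2 * c) \<tau> = 2"
    if ev: "\<And>v. v \<in> pverts G \<Longrightarrow> neighbour_sum f v = k * c * f v" and u: "u \<in> pverts G" and fu: "f u \<noteq> 0"
    for c :: real and f :: "'v \<Rightarrow> real" and u
  proof -
    let ?g = "\<lambda>(w, v). f v"
    have "inflow ((grover_step ^^ \<tau>) ?g) u = inflow ?g u"
      unfolding inflow_def by (intro sum.cong refl per) auto
    then show ?thesis
      using inflow_funpow_eigenvector[OF k ev u, of \<tau>] inflow_funpow_eigenvector[OF k ev u, of 0] fu k
      by simp
  qed
  with \<tau> that show ?thesis by blast
qed

section \<open>A sufficient condition: the cubic relation\<close>

lemma sum_arcs:
  "(\<Sum>u\<in>pverts G. \<Sum>w | (w, u) \<in> parcs G. h (w, u)) = (\<Sum>a\<in>parcs G. h a)" for h :: "'v \<times> 'v \<Rightarrow> real"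
  by (subst sum.Sigma)
     (auto simp: finite_neighbours dest: arc_verts
       intro!: sum.reindex_bij_witness[of _ prod.swap prod.swap])

lemma sum_arcs_swap:
  "(\<Sum>a\<in>parcs G. h (prod.swap a)) = (\<Sum>a\<in>parcs G. h a)" for h :: "'v \<times> 'v \<Rightarrow> real"
  by (rule sum.reindex_bij_witness[of _ prod.swap prod.swap]) (auto simp: arc_sym)

text \<open>Each \<open>inflow g u\<close> is spread with weight \<open>2 / k\<close> over the
  \<open>k\<close> arcs at \<open>u\<close>, giving twice the total, and the reflected term removes
  the total once. This invariant becomes the inhomogeneous term of the recurrence below.\<close>

lemma sum_inflow_grover_step:
  assumes k: "k > 0"
  shows "(\<Sum>u\<in>pverts G. inflow (grover_step g) u) = (\<Sum>u\<in>pverts G. inflow g u)"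
proof -
  have "(\<Sum>u\<in>pverts G. inflow (grover_step g) u) = (\<Sum>a\<in>parcs G. grover_step g a)"
    unfolding inflow_def by (rule sum_arcs)
  also have "\<dots> = (\<Sum>a\<in>parcs G. 2 / k * inflow g (fst a)) - (\<Sum>a\<in>parcs G. g (prod.swap a))"
    unfolding sum_subtractf[symmetric] by (intro sum.cong) (auto simp: grover_step_pair)
  also have "(\<Sum>a\<in>parcs G. 2 / k * inflow g (fst a)) = (\<Sum>a\<in>parcs G. 2 / k * inflow g (snd a))"
    by (subst sum_arcs_swap[symmetric]) simp
  also have "\<dots> = (\<Sum>u\<in>pverts G. 2 * inflow g u)"
    using k by (subst sum_arcs[symmetric]) (auto intro!: sum.cong simp: card_in_neighbours)
  also have "(\<Sum>a\<in>parcs G. g (prod.swap a)) = (\<Sum>u\<in>pverts G. inflow g u)"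
    unfolding inflow_def sum_arcs by (rule sum_arcs_swap)
  finally show ?thesis by (simp flip: sum_distrib_left)
qed

lemma neighbour_sum_cong:
  "(\<And>w. w \<in> pverts G \<Longrightarrow> f w = h w) \<Longrightarrow> neighbour_sum f u = neighbour_sum h u"
  unfolding neighbour_sum_def by (intro sum.cong) (auto dest: arc_verts)

lemma neighbour_sum_lin:
  "neighbour_sum (\<lambda>w. a * (f w + h w)) u = a * (neighbour_sum f u + neighbour_sum h u)"
  by (simp add: neighbour_sum_def sum.distrib flip: sum_distrib_left)

text \<open>If \<open>X\<close> is the time shift, the neighbour sum acts on vertex sums as
  \<open>m * (X + 1 / X)\<close>. Up to a power of \<open>X\<close>, the cubic becomes \<open>X^6 +
  X^5 + 2 X^4 + 2 X^3 + 2 X^2 + X + 1 = (X^2 + 1) (X^4 + X^3 + X^2 + X + 1)\<close>, whose roots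
  have orders 4 and 5; hence the period 20.\<close>

lemma grover_periodic_of_cubic:
  fixes m :: real
  assumes km: "k = 2 * m" and m: "m > 0"
    and cubic: "\<And>F u. u \<in> pverts G \<Longrightarrow>
      neighbour_sum (neighbour_sum (neighbour_sum F)) u + m * neighbour_sum (neighbour_sum F) u
        - m\<^sup>2 * neighbour_sum F u = 2 * m\<^sup>2 * sum F (pverts G)"
  shows "grover_periodic G"
proof -
  have k: "k > 0" using km m by (cases "k = 0") auto
  have "(grover_step ^^ 20) g (u, v) = g (u, v)" if uv: "(u, v) \<in> parcs G" for g u v
  proof -
    define F where "F n = inflow ((grover_step ^^ n) g)" for n
    define C where "C = sum (F 0) (pverts G)"
    have sumF: "sum (F n) (pverts G) = C" for n
      by (induction n) (simp_all add: C_def F_def sum_inflow_grover_step[OF k])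
    have A1: "neighbour_sum (F (Suc n)) u = m * (F (Suc (Suc n)) u + F n u)" if "u \<in> pverts G" for n u
      using inflow_grover_step2[OF that k, of "(grover_step ^^ n) g"] m
      by (simp add: F_def km field_simps)
    have A2: "neighbour_sum (neighbour_sum (F (Suc (Suc n)))) u
        = m\<^sup>2 * (F (n + 4) u + 2 * F (n + 2) u + F n u)" if u: "u \<in> pverts G" for n u
    proof -
      have "neighbour_sum (neighbour_sum (F (Suc (Suc n)))) u
        = neighbour_sum (\<lambda>u. m * (F (Suc (Suc (Suc n))) u + F (Suc n) u)) u"
        by (rule neighbour_sum_cong) (rule A1)
      also have "\<dots> = m * (neighbour_sum (F (Suc (Suc (Suc n)))) u + neighbour_sum (F (Suc n)) u)"
        by (rule neighbour_sum_lin)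
      finally show ?thesis
        by (simp add: A1[OF u] eval_nat_numeral algebra_simps)
    qed
    have A3: "neighbour_sum (neighbour_sum (neighbour_sum (F (Suc (Suc (Suc n)))))) u
        = m^3 * (F (n + 6) u + 3 * F (n + 4) u + 3 * F (n + 2) u + F n u)" if u: "u \<in> pverts G" for n u
    proof -
      have "neighbour_sum (neighbour_sum (neighbour_sum (F (Suc (Suc (Suc n)))))) u
        = neighbour_sum (neighbour_sum (\<lambda>u. m * (F (Suc (Suc (Suc (Suc n)))) u + F (Suc (Suc n)) u))) u"
        by (intro neighbour_sum_cong) (rule A1)
      also have "\<dots> = m * (neighbour_sum (neighbour_sum (F (Suc (Suc (Suc (Suc n)))))) u
          + neighbour_sum (neighbour_sum (F (Suc (Suc n)))) u)"
        unfolding neighbour_sum_lin ..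
      finally show ?thesis
        by (simp add: A2[OF u] eval_nat_numeral algebra_simps)
    qed
    have rec: "F (n + 6) u + F (n + 5) u + 2 * F (n + 4) u + 2 * F (n + 3) u + 2 * F (n + 2) u
        + F (n + 1) u + F n u = 2 * C / m" if u: "u \<in> pverts G" for n u
    proof -
      have "m^3 * (F (n + 6) u + 3 * F (n + 4) u + 3 * F (n + 2) u + F n u)
        + m * (m\<^sup>2 * (F (n + 5) u + 2 * F (n + 3) u + F (n + 1) u))
        - m\<^sup>2 * (m * (F (n + 4) u + F (n + 2) u)) = 2 * m\<^sup>2 * C"
        using cubic[OF u, of "F (Suc (Suc (Suc n)))"] A3[OF u, of n] A2[OF u, of "Suc n"] A1[OF u, of "Suc (Suc n)"]
        by (simp add: sumF eval_nat_numeral)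
      then have "m\<^sup>2 * (m * (F (n + 6) u + F (n + 5) u + 2 * F (n + 4) u + 2 * F (n + 3) u + 2 * F (n + 2) u
        + F (n + 1) u + F n u)) = m\<^sup>2 * (2 * C)"
        by (simp add: algebra_simps power2_eq_square power3_eq_cube)
      then have "m * (F (n + 6) u + F (n + 5) u + 2 * F (n + 4) u + 2 * F (n + 3) u + 2 * F (n + 2) u
        + F (n + 1) u + F n u) = 2 * C" (is "m * ?S = _")
        using m by (simp only: mult_cancel_left power_eq_0_iff) simp
      then show "?S = 2 * C / m" using m by (metis nonzero_mult_div_cancel_left less_irrefl)
    qed
    \<comment> \<open>The total over ten alternate times depends neither on the vertex nor on the
      start. The multiplier used below has value 1 at \<open>X = 1\<close>, so the constant
      \<open>2 * C / m\<close> survives unchanged.\<close>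
    have alt: "(\<Sum>j<10. F (n + 2 * j) u) = 2 * C / m" if u: "u \<in> pverts G" for n u
    proof -
      define f where "f j = F (n + j) u" for j
      have r: "f (j + 6) + f (j + 5) + 2 * f (j + 4) + 2 * f (j + 3) + 2 * f (j + 2) + f (j + 1) + f j = 2 * C / m" for j
        using rec[OF u, of "n + j"] by (simp only: f_def add.assoc)
      \<comment> \<open>The quotient of \<open>(X\<^sup>2\<^sup>0 - 1) / (X\<^sup>2 - 1)\<close> by the characteristic polynomial of the
        recurrence is \<open>1 - X + X\<^sup>4 - X\<^sup>6 + X\<^sup>8 - X\<^sup>1\<^sup>1 + X\<^sup>1\<^sup>2\<close>.\<close>
      have "f 0 + f 2 + f 4 + f 6 + f 8 + f 10 + f 12 + f 14 + f 16 + f 18 = 2 * C / m"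
        using r[of 0] r[of 1] r[of 4] r[of 6] r[of 8] r[of 11] r[of 12]
        by (simp del: One_nat_def add_2_eq_Suc add_2_eq_Suc')
      then have "(\<Sum>j<10. f (2 * j)) = 2 * C / m"
        by (simp add: lessThan_nat_numeral lessThan_Suc add.commute add.left_commute
            del: add_2_eq_Suc add_2_eq_Suc')
      then show ?thesis unfolding f_def .
    qed
    \<comment> \<open>Iterating \<open>grover_step2\<close> telescopes: odd times contribute at
      \<open>u\<close> and even times at \<open>v\<close>. For \<open>j = 10\<close> both sums equal
      \<open>2 * C / m\<close> by \<open>alt\<close> and cancel.\<close>
    have step: "(grover_step ^^ (2 * j)) g (u, v) = 2 / k * ((\<Sum>i<j. F (1 + 2 * i) u) - (\<Sum>i<j. F (0 + 2 * i) v)) + g (u, v)" for j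
      by (induction j) (simp_all add: grover_step2 F_def algebra_simps)
    show ?thesis
      using step[of 10] alt[of u 1] alt[of v 0] arc_verts[OF uv] by simp
  qed
  then show ?thesis
    unfolding grover_periodic_iff by (intro exI[of _ 20]) auto
qed

end

section \<open>Integrality of Chebyshev values\<close>

text \<open>Multiplying \<open>r + s * y\<close> by \<open>y\<close> gives
  \<open>c * s + (r + s) * y\<close>, so after one multiplication the constant term is divisible by
  \<open>c\<close>. The coefficients are chosen before \<open>y\<close> because both roots of the
  quadratic must share them.\<close>

lemma quadratic_integer_power:
  "\<exists>r s :: int. (\<forall>y :: real. y\<^sup>2 = y + of_int c \<longrightarrow> y ^ n = of_int r + of_int s * y) \<and> (n > 0 \<longrightarrow> c dvd r)"
proof (induction n)
  case 0
  show ?case by (intro exI[of _ 1] exI[of _ 0]) simp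
next
  case (Suc n)
  then obtain r s :: int where rs: "\<And>y :: real. y\<^sup>2 = y + of_int c \<Longrightarrow> y ^ n = of_int r + of_int s * y"
    by blast
  have "y ^ Suc n = of_int (c * s) + of_int (r + s) * y" if y: "y\<^sup>2 = y + of_int c" for y :: real
  proof -
    have "y ^ Suc n = of_int r * y + of_int s * y\<^sup>2"
      by (simp add: rs[OF y] power2_eq_square algebra_simps)
    then show ?thesis by (simp add: y algebra_simps)
  qed
  then show ?case by (intro exI[of _ "c * s"] exI[of _ "r + s"]) simp
qed

text \<open>The factor \<open>y ^ n\<close> clears the denominators of \<open>x = 1 / y\<close> and
  turns the recurrence into \<open>d (n + 2) = d (n + 1) - y^2 * d n\<close>. As
  \<open>y^2 * (u + v * y)\<close> has constant term \<open>c * (u + v)\<close>, the constant term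
  modulo \<open>c\<close> stays what it is at \<open>n = 1\<close>, namely 1; at
  \<open>n = 0\<close> it is 2.\<close>

lemma quadratic_integer_chebyshev:
  "\<exists>u v :: int. (\<forall>x y :: real. y * x = 1 \<longrightarrow> y\<^sup>2 = y + of_int c \<longrightarrow>
      y ^ n * dilated_chebyshev x n = of_int u + of_int v * y) \<and> (n > 0 \<longrightarrow> [u = 1] (mod c))"
proof (induction n rule: induct_nat_012)
  case 0
  show ?case by (intro exI[of _ 2] exI[of _ 0]) simp
next
  case 1
  show ?case by (intro exI[of _ 1] exI[of _ 0]) simp
next
  case (ge2 n)
  obtain u v :: int where uv: "\<And>x y :: real. y * x = 1 \<Longrightarrow> y\<^sup>2 = y + of_int c \<Longrightarrow>
      y ^ n * dilated_chebyshev x n = of_int u + of_int v * y"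
    using ge2.IH(1) by blast
  obtain u' v' :: int where uv': "\<And>x y :: real. y * x = 1 \<Longrightarrow> y\<^sup>2 = y + of_int c \<Longrightarrow>
      y ^ Suc n * dilated_chebyshev x (Suc n) = of_int u' + of_int v' * y" and u': "[u' = 1] (mod c)"
    using ge2.IH(2) by blast
  have "y ^ Suc (Suc n) * dilated_chebyshev x (Suc (Suc n))
      = of_int (u' - c * (u + v)) + of_int (v' - u - v - c * v) * y"
    if x: "y * x = 1" and y: "y\<^sup>2 = y + of_int c" for x y :: real
  proof -
    have "y ^ Suc (Suc n) * dilated_chebyshev x (Suc (Suc n))
      = (y * x) * (y ^ Suc n * dilated_chebyshev x (Suc n)) - y\<^sup>2 * (y ^ n * dilated_chebyshev x n)"
      by (simp add: algebra_simps power2_eq_square)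
    also have "\<dots> = of_int u' + of_int v' * y - y\<^sup>2 * of_int u - of_int v * (y * y\<^sup>2)"
      unfolding uv[OF x y] uv'[OF x y] x y[symmetric] by (simp add: algebra_simps power2_eq_square)
    also have "y * y\<^sup>2 = y + of_int c + of_int c * y"
      by (simp add: y distrib_left flip: power2_eq_square)
    finally show ?thesis by (simp add: y algebra_simps)
  qed
  moreover have "[u' - c * (u + v) = 1] (mod c)"
    using cong_diff[OF u' cong_mult_self_left[of c "u + v"]] by simp
  ultimately show ?case by blast
qed

text \<open>The two preceding lemmas write both sides of
  \<open>y ^ \<tau> * dilated_chebyshev x \<tau> = 2 * y ^ \<tau>\<close> as linear expressions in
  \<open>y\<close>. Agreement at two distinct roots, rational or not, forces equal coefficients. So
  \<open>u = 2 * r\<close>, where \<open>c\<close> divides \<open>r\<close> while \<open>u\<close>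
  is 1 modulo \<open>c\<close>.\<close>

lemma dilated_chebyshev_eq_2_imp_unit:
  fixes x x' y y' :: real and c :: int
  assumes "y * x = 1" "y\<^sup>2 = y + of_int c" "y' * x' = 1" "y'\<^sup>2 = y' + of_int c" "y \<noteq> y'"
    and "dilated_chebyshev x \<tau> = 2" "dilated_chebyshev x' \<tau> = 2" "\<tau> > 0"
  shows "c dvd 1"
proof -
  obtain r s :: int where rs: "\<And>y :: real. y\<^sup>2 = y + of_int c \<Longrightarrow> y ^ \<tau> = of_int r + of_int s * y" and r: "c dvd r"
    using quadratic_integer_power[of c \<tau>] assms(8) by blast
  obtain u v :: int where uv: "\<And>x y :: real. y * x = 1 \<Longrightarrow> y\<^sup>2 = y + of_int c \<Longrightarrow>
      y ^ \<tau> * dilated_chebyshev x \<tau> = of_int u + of_int v * y" and u: "[u = 1] (mod c)"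
    using quadratic_integer_chebyshev[of c \<tau>] assms(8) by blast
  have 1: "of_int (u - 2 * r) + of_int (v - 2 * s) * y = 0" "of_int (u - 2 * r) + of_int (v - 2 * s) * y' = 0"
    using uv[OF assms(1,2)] uv[OF assms(3,4)] rs[OF assms(2)] rs[OF assms(4)] assms(6,7)
    by (simp_all add: algebra_simps)
  then have "of_int (v - 2 * s) * (y - y') = 0" by (simp add: algebra_simps)
  then have "of_int (v - 2 * s) = (0 :: real)" using assms(5) by simp
  with 1 have "of_int (u - 2 * r) = (0 :: real)" by simp
  then have "u = 2 * r" by linarith
  with r have "c dvd u" by simp
  with u show ?thesis by (metis cong_dvd_iff)
qed

text \<open>The scaled values satisfy \<open>w'' = - w' - 4 * w\<close>, so their parity is constant
  from \<open>n = 1\<close> on. This makes concrete that \<open>- 1 / 2\<close> is not an algebraic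
  integer.\<close>

lemma dilated_chebyshev_minus_half:
  "\<exists>w :: int. 2 ^ n * dilated_chebyshev (- 1 / 2) n = of_int w \<and> (n > 0 \<longrightarrow> odd w)"
proof (induction n rule: induct_nat_012)
  case 0
  show ?case by (intro exI[of _ 2]) simp
next
  case 1
  show ?case by (intro exI[of _ "-1"]) simp
next
  case (ge2 n)
  then obtain w w' :: int where w: "2 ^ n * dilated_chebyshev (- 1 / 2) n = of_int w"
    "2 ^ Suc n * dilated_chebyshev (- 1 / 2) (Suc n) = of_int w'" "odd w'" by blast
  have "2 ^ Suc (Suc n) * dilated_chebyshev (- 1 / 2) (Suc (Suc n))
      = - (2 ^ Suc n * dilated_chebyshev (- 1 / 2) (Suc n)) - 4 * (2 ^ n * dilated_chebyshev (- 1 / 2) n)"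
    by (simp add: algebra_simps)
  then have "2 ^ Suc (Suc n) * dilated_chebyshev (- 1 / 2) (Suc (Suc n)) = of_int (- w' - 4 * w)"
    unfolding w by simp
  then show ?case using w(3) by (intro exI[of _ "- w' - 4 * w"]) simp
qed

lemma dilated_chebyshev_minus_half_neq_2:
  assumes "n > 0" shows "dilated_chebyshev (- 1 / 2) n \<noteq> 2"
proof
  assume a: "dilated_chebyshev (- 1 / 2) n = 2"
  obtain w :: int where w: "2 ^ n * dilated_chebyshev (- 1 / 2) n = of_int w" "odd w"
    using dilated_chebyshev_minus_half[of n] assms by blast
  have "real_of_int w = of_int (2 ^ n * 2)" using w(1) a by simp
  then have "w = 2 ^ n * 2" by linarith
  with w(2) show False by simp
qed

section \<open>Squares of units in a finite local ring\<close>

text \<open>Deleting a two-element orbit \<open>{x, f x}\<close> leaves a smaller set with the same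
  properties.\<close>

lemma even_card_of_involution:
  assumes "finite A" "\<And>x. x \<in> A \<Longrightarrow> f x \<in> A" "\<And>x. x \<in> A \<Longrightarrow> f (f x) = x" "\<And>x. x \<in> A \<Longrightarrow> f x \<noteq> x"
  shows "even (card A)"
  using assms
proof (induction "card A" arbitrary: A rule: less_induct)
  case less
  show ?case
  proof (cases "A = {}")
    case False
    then obtain x where x: "x \<in> A" by blast
    let ?B = "A - {x, f x}"
    have card: "card A = card ?B + 2"
      using x less.prems(1) less.prems(2,4)[OF x] card_Diff_subset[of "{x, f x}" A] card_mono[of A "{x, f x}"] by simp
    have "even (card ?B)"
    proof (rule less.hyps)
      show "card ?B < card A" using card by simp
      fix y assume y: "y \<in> ?B"
      then show "f (f y) = y" "f y \<noteq> y" using less.prems by auto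
      have "f y \<noteq> x" "f y \<noteq> f x" using y less.prems(3)[OF x] less.prems(3)[of y] by auto
      then show "f y \<in> ?B" using y less.prems(2) by auto
    qed (use less.prems in auto)
    with card show ?thesis by simp
  qed simp
qed

text \<open>The adjacency operator of the graph in the case of interest (see
  \<open>neighbour_sum_eq\<close>), stated for a bare ring so that it can be computed in the local
  factors.\<close>

definition square_sum :: "('a, 'm) ring_scheme \<Rightarrow> ('a \<Rightarrow> real) \<Rightarrow> 'a \<Rightarrow> real" where
  "square_sum R f x = (\<Sum>t\<in>unit_squares R. f (x \<oplus>\<^bsub>R\<^esub> t))"

text \<open>Dividing by the degree makes eigenvalues multiply over direct products. The
  eigenfunction has to be nonzero on the carrier, since its values elsewhere are arbitrary.\<close>

definition normalized_square_eigenvalue :: "('a, 'm) ring_scheme \<Rightarrow> real \<Rightarrow> bool" where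
  "normalized_square_eigenvalue R (e :: real) \<longleftrightarrow> (\<exists>(f :: 'a \<Rightarrow> real) x\<^sub>0. x\<^sub>0 \<in> carrier R \<and> f x\<^sub>0 \<noteq> 0 \<and>
     (\<forall>x\<in>carrier R. square_sum R f x = real (card (unit_squares R)) * e * f x))"

text \<open>The parameter \<open>c\<close> is the constant of the quadratic
  \<open>y^2 = y + c\<close>, whose discriminant \<open>4 * c + 1\<close> is the order of the
  residue field.\<close>

locale finite_local_ring = cring R + maximalideal M R for R (structure) and M +
  fixes c :: nat
  assumes finite_carrier: "finite (carrier R)"
    and unique_maximal: "maximalideal I R \<Longrightarrow> I = M"
    and residue_card: "card (carrier R) div card M = 4 * c + 1"
begin

abbreviation "Q \<equiv> unit_squares R"
abbreviation "m \<equiv> card M"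

lemma M_carr: "x \<in> M \<Longrightarrow> x \<in> carrier R"
  by (rule Icarr)

lemma finite_M: "finite M"
  by (rule finite_subset[OF _ finite_carrier]) (auto intro: M_carr)

lemma Q_subset_Units: "Q \<subseteq> Units R"
  by (auto simp: unit_squares_def intro: Units_pow_closed)

lemma Q_carr: "x \<in> Q \<Longrightarrow> x \<in> carrier R"
  using Q_subset_Units by auto

lemma finite_Q: "finite Q"
  by (rule finite_subset[OF _ finite_carrier]) (auto intro: Q_carr)

lemma one_notin_M: "\<one> \<notin> M"
  using one_imp_carrier I_notcarr by auto

lemma Units_eq: "Units R = carrier R - M"
proof (intro equalityI subsetI DiffI)
  fix x assume x: "x \<in> Units R"
  then show "x \<in> carrier R" by (rule Units_closed)
  show "x \<notin> M"
  proof
    assume "x \<in> M"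
    then have "inv x \<otimes> x \<in> M" using x by (intro I_l_closed) auto
    then show False using x one_notin_M by simp
  qed
next
  fix x assume "x \<in> carrier R - M"
  then have x: "x \<in> carrier R" "x \<notin> M" by auto
  show "x \<in> Units R"
  proof (rule ccontr)
    assume nu: "x \<notin> Units R"
    \<comment> \<open>A non-unit generates a proper ideal. By finiteness the proper ideals
      containing \<open>x\<close> have a maximal member, which must be \<open>M\<close>.\<close>
    let ?S = "{I. ideal I R \<and> x \<in> I \<and> I \<noteq> carrier R}"
    have fin: "finite ?S"
      by (rule finite_subset[of _ "Pow (carrier R)"]) (auto simp: finite_carrier dest: ideal.Icarr)
    have "PIdl x \<in> ?S"
    proof (intro CollectI conjI)
      show "ideal (PIdl x) R" using x(1) by (rule cgenideal_ideal)
      show "x \<in> PIdl x" using x(1) by (rule cgenideal_self)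
      show "PIdl x \<noteq> carrier R"
      proof
        assume "PIdl x = carrier R"
        then have "\<one> \<in> PIdl x" by simp
        then obtain y where "y \<in> carrier R" "\<one> = y \<otimes> x" unfolding cgenideal_def by auto
        then have "x \<in> Units R" using x(1) unfolding Units_def by (auto simp: m_comm intro!: bexI[of _ y])
        with nu show False ..
      qed
    qed
    then have "?S \<noteq> {}" by blast
    from finite_has_maximal[OF fin this] obtain I where I: "I \<in> ?S" "\<And>J. J \<in> ?S \<Longrightarrow> I \<subseteq> J \<Longrightarrow> I = J"
      by blast
    have "maximalideal I R"
    proof (rule maximalidealI)
      show "ideal I R" "carrier R \<noteq> I" using I(1) by auto
      show "J = I \<or> J = carrier R" if "ideal J R" "I \<subseteq> J" "J \<subseteq> carrier R" for J
        using I that by blast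
    qed
    then have "I = M" by (rule unique_maximal)
    with I x show False by simp
  qed
qed

lemma card_rcosets: "card (rcosets\<^bsub>add_monoid R\<^esub> M) * m = card (carrier R)"
  using add.lagrange[of M] additive_subgroup.a_subgroup[OF additive_subgroup_axioms]
  by (simp add: order_def)

text \<open>By Lagrange the \<open>div\<close> in \<open>residue_card\<close> is exact.\<close>

lemma card_carrier: "card (carrier R) = (4 * c + 1) * m"
proof -
  from card_rcosets have "m dvd card (carrier R)" by (metis dvd_triv_right)
  then show ?thesis using residue_card by (metis dvd_div_mult_self)
qed

lemma m_pos: "m > 0"
  using finite_M additive_subgroup.zero_closed[OF is_additive_subgroup] by (metis card_gt_0_iff empty_iff)

lemma card_Quot: "card (carrier (R Quot M)) = 4 * c + 1"
proof -
  from card_rcosets have "card (rcosets\<^bsub>add_monoid R\<^esub> M) = 4 * c + 1"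
    using residue_card m_pos by (metis less_irrefl nonzero_mult_div_cancel_right)
  then show ?thesis by (simp add: FactRing_def A_RCOSETS_def)
qed

lemma c_pos: "c > 0"
proof (rule ccontr)
  assume "\<not> c > 0"
  then have "card (carrier R) = m" using card_carrier by simp
  then have "M = carrier R" using finite_carrier M_carr by (intro card_subset_eq) auto
  with I_notcarr show False by simp
qed

text \<open>The residue field has odd order \<open>4 * c + 1\<close>. If 2 vanished there,
  \<open>4 * c + 1\<close> times the identity would be both zero and the identity.\<close>

lemma two_Units: "\<one> \<oplus> \<one> \<in> Units R"
proof (rule ccontr)
  assume "\<one> \<oplus> \<one> \<notin> Units R"
  then have M2: "\<one> \<oplus> \<one> \<in> M" using Units_eq by auto
  interpret F: cring "R Quot M" by (rule quotient_is_cring) (rule is_cring)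
  let ?e = "\<one>\<^bsub>R Quot M\<^esub>"
  have hom: "(+>) M \<in> ring_hom R (R Quot M)" by (rule rcos_ring_hom)
  have e: "?e = M +> \<one>" using ring_hom_one[OF hom] by simp
  have "?e \<oplus>\<^bsub>R Quot M\<^esub> ?e = M +> (\<one> \<oplus> \<one>)" using ring_hom_add[OF hom, of \<one> \<one>] e by simp
  also have "\<dots> = \<zero>\<^bsub>R Quot M\<^esub>" using M2 a_rcos_zero ideal_axioms by (simp add: FactRing_def a_rcos_const)
  finally have 2: "add_pow (R Quot M) (2::nat) ?e = \<zero>\<^bsub>R Quot M\<^esub>"
    by (simp add: numeral_2_eq_2)
  have "add_pow (R Quot M) (4 * c + 1) ?e = \<zero>\<^bsub>R Quot M\<^esub>"
    using F.add.pow_order_eq_1[of ?e] card_Quot by (simp add: order_def)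
  moreover have "add_pow (R Quot M) (4 * c + 1) ?e = add_pow (R Quot M) (2 * (2 * c)) ?e \<oplus>\<^bsub>R Quot M\<^esub> ?e"
    by simp
  moreover have "add_pow (R Quot M) (2 * (2 * c)) ?e = add_pow (R Quot M) (2 * c) (add_pow (R Quot M) (2::nat) ?e)"
    by (simp only: F.add.nat_pow_pow F.one_closed)
  ultimately have "?e = \<zero>\<^bsub>R Quot M\<^esub>" using 2 by simp
  then have "M +> \<one> = M" using e by (simp add: FactRing_def)
  then have "\<one> \<in> M" by (rule rcos_const_imp_mem[OF one_closed])
  with one_notin_M show False ..
qed

text \<open>The factors \<open>u - v\<close> and \<open>u + v\<close> of zero cannot both lie in
  \<open>M\<close>, because their sum is the unit \<open>2 * u\<close>. So one is a unit and the
  other is zero.\<close>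

lemma square_eq_imp:
  assumes u: "u \<in> Units R" and v: "v \<in> Units R" and eq: "u [^] (2::nat) = v [^] (2::nat)"
  shows "u = v \<or> u = \<ominus> v"
proof -
  have uc: "u \<in> carrier R" and vc: "v \<in> carrier R" using u v Units_closed by auto
  have 0: "(u \<ominus> v) \<otimes> (u \<oplus> v) = \<zero>"
  proof -
    have "(u \<ominus> v) \<otimes> (u \<oplus> v) = u \<otimes> u \<ominus> v \<otimes> v"
      using uc vc by algebra
    then show ?thesis using eq uc vc by (simp add: numeral_2_eq_2 minus_eq r_neg)
  qed
  have "u \<ominus> v \<in> Units R \<or> u \<oplus> v \<in> Units R"
  proof (rule ccontr)
    assume "\<not> ?thesis"
    then have "u \<ominus> v \<in> M" "u \<oplus> v \<in> M" using Units_eq uc vc by auto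
    then have "(u \<ominus> v) \<oplus> (u \<oplus> v) \<in> M"
      using additive_subgroup.a_closed[OF is_additive_subgroup] by blast
    moreover have "(u \<ominus> v) \<oplus> (u \<oplus> v) = u \<otimes> (\<one> \<oplus> \<one>)" using uc vc by algebra
    moreover have "u \<otimes> (\<one> \<oplus> \<one>) \<in> Units R" using u two_Units by simp
    ultimately show False using Units_eq by auto
  qed
  then show ?thesis
  proof
    assume w: "u \<ominus> v \<in> Units R"
    have "u \<oplus> v = \<zero>" using 0 Units_l_cancel[OF w, of "u \<oplus> v" \<zero>] uc vc by simp
    then show ?thesis using uc vc minus_equality by blast
  next
    assume w: "u \<oplus> v \<in> Units R"
    have "(u \<oplus> v) \<otimes> (u \<ominus> v) = \<zero>" using 0 uc vc by (simp add: m_comm)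
    then have "u \<ominus> v = \<zero>" using Units_l_cancel[OF w, of "u \<ominus> v" \<zero>] uc vc by simp
    then show ?thesis using uc vc by (simp add: r_right_minus_eq)
  qed
qed

lemma minus_Units: "u \<in> Units R \<Longrightarrow> \<ominus> u \<in> Units R"
  using Units_eq additive_subgroup.a_inv_closed[OF is_additive_subgroup, of "\<ominus> u"] Units_closed by auto

lemma minus_neq: "u \<in> Units R \<Longrightarrow> \<ominus> u \<noteq> u"
proof
  assume u: "u \<in> Units R" and "\<ominus> u = u"
  then have "u \<otimes> (\<one> \<oplus> \<one>) = \<zero>"
    using Units_closed[OF u] by (metis one_closed r_distr r_neg r_one)
  moreover have "u \<otimes> (\<one> \<oplus> \<one>) \<in> Units R" using u two_Units by simp
  ultimately show False using Units_eq additive_subgroup.zero_closed[OF is_additive_subgroup] by auto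
qed

lemma square_minus: "u \<in> carrier R \<Longrightarrow> (\<ominus> u) [^] (2::nat) = u [^] (2::nat)"
  by (simp add: numeral_2_eq_2 l_minus r_minus)

lemma card_Units: "card (Units R) = 4 * c * m"
proof -
  have "card (Units R) = card (carrier R) - m"
    unfolding Units_eq using finite_M M_carr by (intro card_Diff_subset) auto
  then show ?thesis by (simp add: card_carrier)
qed

lemma finite_Units: "finite (Units R)"
  unfolding Units_eq using finite_carrier by simp

text \<open>By \<open>square_eq_imp\<close> the fibres of squaring on the units are the pairs
  \<open>{v, - v}\<close>, so half of the \<open>4 * c * m\<close> units are squares.\<close>

lemma card_Q: "card Q = 2 * c * m"
proof -
  have "card {x \<in> Units R. x [^] (2::nat) = y} = 2" if y: "y \<in> Q" for y
  proof -
    obtain v where v: "v \<in> Units R" "y = v [^] (2::nat)" using y by (auto simp: unit_squares_def)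
    have "{x \<in> Units R. x [^] (2::nat) = y} = {v, \<ominus> v}"
      using v square_eq_imp minus_Units square_minus Units_closed by auto
    then show ?thesis using minus_neq[OF v(1)] by simp
  qed
  moreover have "card (Units R) = (\<Sum>y\<in>Q. card {x \<in> Units R. x [^] (2::nat) = y})"
    using sum.group[OF finite_Units finite_Q, of "\<lambda>u. u [^] (2::nat)" "\<lambda>_. 1 :: nat"]
    by (force simp: unit_squares_def)
  ultimately show ?thesis using card_Units by simp
qed

lemma Q_mult: "x \<in> Q \<Longrightarrow> y \<in> Q \<Longrightarrow> x \<otimes> y \<in> Q"
  unfolding unit_squares_def
  by clarify (metis Units_closed Units_m_closed nat_pow_distrib)

lemma Q_square: "u \<in> Units R \<Longrightarrow> u \<otimes> u \<in> Q"
  by (auto simp: unit_squares_def numeral_2_eq_2 intro!: exI[of _ u] dest: Units_closed)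

lemma Q_inv:
  assumes "x \<in> Q" shows "inv x \<in> Q"
proof -
  have x: "x \<in> Units R" using assms Q_subset_Units by auto
  then have "x \<otimes> (inv x \<otimes> inv x) \<in> Q" using assms by (intro Q_mult Q_square) auto
  moreover have "x \<otimes> (inv x \<otimes> inv x) = inv x"
    using x by (metis Units_closed Units_inv_closed Units_r_inv l_one m_assoc)
  ultimately show ?thesis by simp
qed

text \<open>Otherwise inversion on \<open>Q\<close> would fix only \<open>\<one>\<close>, while the order of \<open>Q\<close> is even.\<close>
lemma minus_one_Q: "\<ominus> \<one> \<in> Q"
proof (rule ccontr)
  assume n: "\<ominus> \<one> \<notin> Q"
  have one: "\<one> \<in> Q" using Q_square[of \<one>] by simp
  have "even (card (Q - {\<one>}))"
  proof (rule even_card_of_involution[of _ "m_inv R"])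
    fix x assume x: "x \<in> Q - {\<one>}"
    then have xu: "x \<in> Units R" using Q_subset_Units by auto
    show ii: "inv (inv x) = x" using xu by simp
    show "inv x \<in> Q - {\<one>}" using Q_inv x ii by auto
    show "inv x \<noteq> x"
    proof
      assume "inv x = x"
      then have "x [^] (2::nat) = \<one> [^] (2::nat)"
        using xu Units_r_inv[OF xu] by (simp add: numeral_2_eq_2 Units_closed)
      from square_eq_imp[OF xu _ this] x n show False by auto
    qed
  qed (use finite_Q in auto)
  moreover have "card Q = Suc (card (Q - {\<one>}))"
    using one finite_Q by (metis card_Suc_Diff1)
  moreover have "even (card Q)" by (simp add: card_Q)
  ultimately show False by simp
qed

text \<open>No element of \<open>u * Q\<close> is a square, and squares make up half of the units,
  so by counting \<open>u * Q\<close> is the whole set of nonsquares. Then \<open>v = u * w\<close>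
  with \<open>w\<close> in \<open>Q\<close>, and \<open>u * v = u^2 * w\<close>.\<close>

lemma nonsquares_mult:
  assumes u: "u \<in> Units R - Q" and v: "v \<in> Units R - Q"
  shows "u \<otimes> v \<in> Q"
proof -
  have uU: "u \<in> Units R" using u by simp
  have "(\<lambda>x. u \<otimes> x) ` Q \<subseteq> Units R - Q"
  proof (safe)
    fix x assume x: "x \<in> Q"
    show "u \<otimes> x \<in> Units R" using uU x Q_subset_Units by auto
    assume "u \<otimes> x \<in> Q"
    then have "(u \<otimes> x) \<otimes> inv x \<in> Q" using Q_mult Q_inv x by blast
    moreover have "(u \<otimes> x) \<otimes> inv x = u"
      using uU x Q_subset_Units by (metis Q_carr Units_closed Units_inv_closed Units_r_inv m_assoc r_one subsetD)
    ultimately show False using u by simp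
  qed
  moreover have "card ((\<lambda>x. u \<otimes> x) ` Q) = card Q"
    using Units_l_cancel[OF uU] Q_carr by (intro card_image) (auto simp: inj_on_def)
  moreover have "card (Units R - Q) = card Q"
    using card_Diff_subset[OF finite_Q Q_subset_Units] card_Units card_Q by simp
  ultimately have "(\<lambda>x. u \<otimes> x) ` Q = Units R - Q"
    using finite_Units by (intro card_subset_eq) auto
  then obtain w where w: "w \<in> Q" "v = u \<otimes> w" using v by blast
  then have "u \<otimes> v = (u \<otimes> u) \<otimes> w" using uU Q_carr Units_closed by (simp add: m_assoc)
  then show ?thesis using Q_mult[OF Q_square[OF uU] w(1)] by simp
qed

lemma one_plus_M_Units: "n \<in> M \<Longrightarrow> \<one> \<oplus> n \<in> Units R"
proof (rule ccontr)
  assume n: "n \<in> M" and "\<one> \<oplus> n \<notin> Units R"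
  then have "\<one> \<oplus> n \<in> M" using Units_eq M_carr[OF n] by auto
  then have "(\<one> \<oplus> n) \<oplus> \<ominus> n \<in> M" using n additive_subgroup.a_closed[OF is_additive_subgroup]
      additive_subgroup.a_inv_closed[OF is_additive_subgroup] by blast
  moreover have "(\<one> \<oplus> n) \<oplus> \<ominus> n = \<one>" using M_carr[OF n] by algebra
  ultimately show False using one_notin_M by simp
qed

text \<open>Squaring is injective, hence bijective, on \<open>\<one> + M\<close>.\<close>
lemma one_plus_M_Q:
  assumes n: "n \<in> M" shows "\<one> \<oplus> n \<in> Q"
proof -
  let ?P = "(\<lambda>n. \<one> \<oplus> n) ` M"
  have sub: "(\<lambda>x. x \<otimes> x) ` ?P \<subseteq> ?P"
  proof safe
    fix a assume a: "a \<in> M"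
    have "(\<one> \<oplus> a) \<otimes> (\<one> \<oplus> a) = \<one> \<oplus> (\<one> \<oplus> \<one> \<oplus> a) \<otimes> a" using M_carr[OF a] by algebra
    moreover have "(\<one> \<oplus> \<one> \<oplus> a) \<otimes> a \<in> M" using a M_carr by (intro I_l_closed) auto
    ultimately show "(\<one> \<oplus> a) \<otimes> (\<one> \<oplus> a) \<in> ?P" by simp
  qed
  have "inj_on (\<lambda>x. x \<otimes> x) ?P"
  proof (rule inj_onI, elim imageE, hypsubst)
    fix a b assume a: "a \<in> M" and b: "b \<in> M"
      and eq: "(\<one> \<oplus> a) \<otimes> (\<one> \<oplus> a) = (\<one> \<oplus> b) \<otimes> (\<one> \<oplus> b)"
    have ac: "a \<in> carrier R" and bc: "b \<in> carrier R" using a b M_carr by auto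
    \<comment> \<open>The opposite sign would put 2 into \<open>M\<close>.\<close>
    have "\<one> \<oplus> a \<noteq> \<ominus> (\<one> \<oplus> b)"
    proof
      assume h: "\<one> \<oplus> a = \<ominus> (\<one> \<oplus> b)"
      have "\<one> \<oplus> \<one> = (\<one> \<oplus> a) \<oplus> (\<one> \<oplus> b) \<oplus> (\<ominus> a \<oplus> \<ominus> b)" using ac bc by algebra
      also have "\<dots> = \<ominus> a \<oplus> \<ominus> b" using ac bc by (simp add: h l_neg)
      also have "\<dots> \<in> M" using a b additive_subgroup.a_closed[OF is_additive_subgroup]
        additive_subgroup.a_inv_closed[OF is_additive_subgroup] by blast
      finally show False using two_Units Units_eq by auto
    qed
    moreover have "(\<one> \<oplus> a) [^] (2::nat) = (\<one> \<oplus> b) [^] (2::nat)"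
      using eq ac bc by (simp add: numeral_2_eq_2)
    ultimately show "\<one> \<oplus> a = \<one> \<oplus> b"
      using square_eq_imp[OF one_plus_M_Units[OF a] one_plus_M_Units[OF b]] by blast
  qed
  with sub have "(\<lambda>x. x \<otimes> x) ` ?P = ?P" using finite_M by (intro endo_inj_surj) auto
  then have "\<one> \<oplus> n \<in> (\<lambda>x. x \<otimes> x) ` ?P" using n by blast
  then obtain x where "x \<in> ?P" "\<one> \<oplus> n = x \<otimes> x" by blast
  then show ?thesis using Q_square one_plus_M_Units by auto
qed

text \<open>Writing \<open>u + n\<close> as \<open>u * (1 + n / u)\<close> reduces this to
  \<open>one_plus_M_Q\<close>. So \<open>Q\<close> is a union of cosets of \<open>M\<close>, which
  is why the graph is a blow-up.\<close>

lemma Q_plus_M: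
  assumes u: "u \<in> Q" and n: "n \<in> M" shows "u \<oplus> n \<in> Q"
proof -
  have uU: "u \<in> Units R" using u Q_subset_Units by auto
  have "u \<oplus> n = u \<otimes> (\<one> \<oplus> inv u \<otimes> n)"
  proof -
    have "u \<otimes> (\<one> \<oplus> inv u \<otimes> n) = u \<oplus> (u \<otimes> inv u) \<otimes> n"
      using Units_closed[OF uU] Units_inv_closed[OF uU] M_carr[OF n] by algebra
    then show ?thesis using uU M_carr[OF n] by simp
  qed
  moreover have "inv u \<otimes> n \<in> M" using n uU by (intro I_l_closed) auto
  ultimately show ?thesis using Q_mult[OF u one_plus_M_Q] by simp
qed

section \<open>The quadratic character of the residue field, lifted to the ring\<close>

definition quadratic_character :: "'a \<Rightarrow> real" where
  "quadratic_character x = (if x \<in> M then 0 else if x \<in> Q then 1 else -1)"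

abbreviation "\<chi> \<equiv> quadratic_character"
abbreviation "in_M \<equiv> indicator M :: 'a \<Rightarrow> real"
abbreviation "in_Q \<equiv> indicator Q :: 'a \<Rightarrow> real"

lemma character_Units: "x \<in> Units R \<Longrightarrow> \<chi> x = (if x \<in> Q then 1 else -1)"
  using Units_eq by (auto simp: quadratic_character_def)

lemma character_mult:
  assumes u: "u \<in> Units R" and x: "x \<in> carrier R" shows "\<chi> (u \<otimes> x) = \<chi> u * \<chi> x"
proof (cases "x \<in> M")
  case True
  then have "u \<otimes> x \<in> M" using u by (intro I_l_closed) auto
  with True show ?thesis by (simp add: quadratic_character_def)
next
  case False
  then have xU: "x \<in> Units R" using x Units_eq by auto
  have 1: "u \<in> Q" if "u \<otimes> x \<in> Q" "x \<in> Q"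
  proof -
    have "u = (u \<otimes> x) \<otimes> inv x"
      using u xU by (simp add: m_assoc Units_closed)
    then show ?thesis using Q_mult[OF that(1) Q_inv[OF that(2)]] by simp
  qed
  have 2: "x \<in> Q" if "u \<otimes> x \<in> Q" "u \<in> Q"
  proof -
    have "x = inv u \<otimes> (u \<otimes> x)"
      using u xU by (simp add: m_assoc[symmetric] Units_closed)
    then show ?thesis using Q_mult[OF Q_inv[OF that(2)] that(1)] by simp
  qed
  have "u \<otimes> x \<in> Q \<longleftrightarrow> (u \<in> Q \<longleftrightarrow> x \<in> Q)"
    using u xU 1 2 Q_mult[of u x] nonsquares_mult[of u x] by blast
  moreover have "u \<otimes> x \<in> Units R" using u xU by simp
  ultimately show ?thesis using u xU by (simp add: character_Units)
qed

lemma minus_one_Units: "\<ominus> \<one> \<in> Units R"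
  by (rule minus_Units) simp

lemma character_minus: "x \<in> carrier R \<Longrightarrow> \<chi> (\<ominus> x) = \<chi> x"
  using character_mult[OF minus_one_Units, of x] minus_one_Q character_Units[OF minus_one_Units]
  by (simp add: l_minus)

lemma character_plus_M:
  assumes x: "x \<in> carrier R" and n: "n \<in> M" shows "\<chi> (x \<oplus> n) = \<chi> x"
proof -
  have nc: "n \<in> carrier R" and n': "\<ominus> n \<in> M"
    using n M_carr additive_subgroup.a_inv_closed[OF is_additive_subgroup] by auto
  have undo_n: "(x \<oplus> n) \<oplus> \<ominus> n = x" using x nc by algebra
  have "x \<oplus> n \<in> M \<longleftrightarrow> x \<in> M"
    using n n' undo_n additive_subgroup.a_closed[OF is_additive_subgroup] by metis
  moreover have "x \<oplus> n \<in> Q \<longleftrightarrow> x \<in> Q" using Q_plus_M n n' undo_n by metis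
  ultimately show ?thesis by (simp add: quadratic_character_def)
qed

lemma sum_minus:
  assumes x: "x \<in> carrier R" shows "(\<Sum>t\<in>carrier R. h (x \<ominus> t)) = (\<Sum>t\<in>carrier R. h t)"
proof (rule sum.reindex_bij_witness[of _ "\<lambda>t. x \<ominus> t" "\<lambda>t. x \<ominus> t"])
  fix t assume t: "t \<in> carrier R"
  show "x \<ominus> (x \<ominus> t) = t" using x t by algebra
  then show "x \<ominus> (x \<ominus> t) = t" .
qed (use x in auto)

lemma sum_plus:
  assumes x: "x \<in> carrier R" shows "(\<Sum>t\<in>carrier R. h (x \<oplus> t)) = (\<Sum>t\<in>carrier R. h t)"
proof (rule sum.reindex_bij_witness[of _ "\<lambda>t. t \<ominus> x" "\<lambda>t. x \<oplus> t"])
  fix t assume t: "t \<in> carrier R"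
  show "x \<oplus> t \<ominus> x = t" using x t by algebra
  show "x \<oplus> (t \<ominus> x) = t" using x t by algebra
qed (use x in auto)

lemma carrier_eq: "carrier R = M \<union> Units R" "M \<inter> Units R = {}"
  unfolding Units_eq using M_carr by blast+

lemma sum_carrier_split: "(\<Sum>t\<in>carrier R. h t) = (\<Sum>t\<in>M. h t) + (\<Sum>t\<in>Units R. h t)"
  unfolding carrier_eq(1) using finite_M finite_Units carrier_eq(2) by (rule sum.union_disjoint)

lemma sum_character: "(\<Sum>t\<in>carrier R. \<chi> t) = 0"
proof -
  have "(\<Sum>t\<in>Units R. \<chi> t) = (\<Sum>t\<in>Units R - Q. \<chi> t) + (\<Sum>t\<in>Q. \<chi> t)"
    using Q_subset_Units finite_Units by (rule sum.subset_diff)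
  also have "(\<Sum>t\<in>Q. \<chi> t) = (\<Sum>t\<in>Q. 1)"
    using Q_subset_Units by (intro sum.cong) (auto simp: character_Units subset_iff)
  also have "(\<Sum>t\<in>Units R - Q. \<chi> t) = (\<Sum>t\<in>Units R - Q. -1)"
    by (intro sum.cong) (auto simp: character_Units)
  finally have "(\<Sum>t\<in>Units R. \<chi> t) = 0"
    using card_Diff_subset[OF finite_Q Q_subset_Units] card_Units card_Q by simp
  then show ?thesis by (simp add: sum_carrier_split quadratic_character_def)
qed

lemma character_square: "u \<in> Units R \<Longrightarrow> \<chi> u * \<chi> u = 1"
  by (simp add: character_Units)

text \<open>For \<open>x\<close> in \<open>M\<close>, each of the \<open>4 * c * m\<close> units
  \<open>y\<close> contributes \<open>\<chi> y * \<chi> (- y) = 1\<close>. For a unit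
  \<open>x\<close>, the substitution \<open>z = x / y\<close> turns the terms into
  \<open>\<chi> (z - 1)\<close>. Their sum over the ring vanishes, and the part over
  \<open>M\<close> consists of \<open>m\<close> terms \<open>\<chi> (- 1) = 1\<close>.\<close>

lemma jacobi_sum:
  assumes x: "x \<in> carrier R"
  shows "(\<Sum>y\<in>carrier R. \<chi> y * \<chi> (x \<ominus> y)) = m * ((4 * c + 1) * in_M x - 1)"
proof (cases "x \<in> M")
  case True
  have "(\<Sum>y\<in>carrier R. \<chi> y * \<chi> (x \<ominus> y)) = (\<Sum>y\<in>Units R. \<chi> y * \<chi> (x \<ominus> y))"
    by (simp add: sum_carrier_split quadratic_character_def)
  also have "\<dots> = (\<Sum>y\<in>Units R. 1)"
  proof (rule sum.cong)
    fix y assume y: "y \<in> Units R"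
    have "\<chi> (x \<ominus> y) = \<chi> (\<ominus> y \<oplus> x)" using x Units_closed[OF y] by (simp add: minus_eq a_comm)
    also have "\<dots> = \<chi> y" using Units_closed[OF y] True by (simp add: character_plus_M character_minus)
    finally show "\<chi> y * \<chi> (x \<ominus> y) = 1" using character_square[OF y] by simp
  qed simp
  finally show ?thesis using True card_Units by simp
next
  case False
  then have xU: "x \<in> Units R" using x Units_eq by auto
  \<comment> \<open>Sending \<open>y\<close> to \<open>x / y\<close> is its own inverse, so one map
    provides both witnesses of the reindexing.\<close>
  have inv_inv: "x \<otimes> inv (x \<otimes> inv y) = y" if y: "y \<in> Units R" for y
  proof -
    have yc: "y \<in> carrier R" "inv y \<in> carrier R" using y by (auto simp: Units_closed)
    have U: "x \<otimes> inv y \<in> Units R" using xU y by simp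
    have "x = y \<otimes> (x \<otimes> inv y)"
      using x yc Units_r_inv[OF y] by (simp add: m_lcomm[of y x])
    then have "x \<otimes> inv (x \<otimes> inv y) = y \<otimes> (x \<otimes> inv y) \<otimes> inv (x \<otimes> inv y)"
      by (rule arg_cong)
    also have "\<dots> = y \<otimes> ((x \<otimes> inv y) \<otimes> inv (x \<otimes> inv y))"
      using x yc U by (intro m_assoc) auto
    finally show ?thesis using yc U by simp
  qed
  have "(\<Sum>y\<in>carrier R. \<chi> y * \<chi> (x \<ominus> y)) = (\<Sum>y\<in>Units R. \<chi> y * \<chi> (x \<ominus> y))"
    by (simp add: sum_carrier_split quadratic_character_def)
  also have "\<dots> = (\<Sum>z\<in>Units R. \<chi> (z \<ominus> \<one>))"
  proof (rule sum.reindex_bij_witness[of _ "\<lambda>z. x \<otimes> inv z" "\<lambda>y. x \<otimes> inv y"])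
    fix y assume y: "y \<in> Units R"
    have yc: "y \<in> carrier R" "inv y \<in> carrier R" using y by (auto simp: Units_closed)
    show U: "x \<otimes> inv y \<in> Units R" using xU y by simp
    have "\<chi> (x \<ominus> y) = \<chi> (y \<otimes> (x \<otimes> inv y \<ominus> \<one>))"
    proof -
      have "y \<otimes> (x \<otimes> inv y \<ominus> \<one>) = x \<otimes> (y \<otimes> inv y) \<ominus> y" using x yc by algebra
      then show ?thesis using y x by simp
    qed
    also have "\<dots> = \<chi> y * \<chi> (x \<otimes> inv y \<ominus> \<one>)" using y x yc by (intro character_mult) auto
    finally show "\<chi> (x \<otimes> inv y \<ominus> \<one>) = \<chi> y * \<chi> (x \<ominus> y)"
      using character_square[OF y] by (simp add: mult.assoc[symmetric])
  qed (use xU inv_inv in simp_all)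
  also have "\<dots> = (\<Sum>z\<in>carrier R. \<chi> (z \<ominus> \<one>)) - (\<Sum>z\<in>M. \<chi> (z \<ominus> \<one>))"
    by (simp add: sum_carrier_split)
  also have "(\<Sum>z\<in>carrier R. \<chi> (z \<ominus> \<one>)) = (\<Sum>z\<in>carrier R. \<chi> (\<ominus> \<one> \<oplus> z))"
    by (intro sum.cong) (auto simp: minus_eq a_comm)
  also have "\<dots> = 0" by (simp add: sum_plus sum_character)
  also have "(\<Sum>z\<in>M. \<chi> (z \<ominus> \<one>)) = (\<Sum>z\<in>M. 1)"
  proof (rule sum.cong)
    fix z assume z: "z \<in> M"
    have "z \<ominus> \<one> = \<ominus> \<one> \<oplus> z" using M_carr[OF z] by (simp add: minus_eq a_comm)
    then show "\<chi> (z \<ominus> \<one>) = 1"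
      using z minus_one_Q minus_one_Units by (simp add: character_plus_M character_Units)
  qed simp
  finally show ?thesis using False by simp
qed

lemma in_Q_eq: "x \<in> carrier R \<Longrightarrow> in_Q x = (1 - in_M x + \<chi> x) / 2"
  using Q_subset_Units Units_eq by (auto simp: quadratic_character_def indicator_def)

lemma sum_in_M: "(\<Sum>t\<in>carrier R. in_M t * h t) = (\<Sum>t\<in>M. h t)"
proof -
  have "(\<Sum>t\<in>carrier R. in_M t * h t) = (\<Sum>t\<in>M. in_M t * h t)"
    using finite_carrier M_carr by (intro sum.mono_neutral_right) auto
  then show ?thesis by simp
qed

text \<open>The sum counts the ways to write \<open>z\<close> as a sum of two unit squares:
  \<open>2 * c * m\<close>, \<open>m * (c - 1)\<close> or \<open>m * c\<close> for \<open>z\<close>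
  in \<open>M\<close>, in \<open>Q\<close> or a nonsquare unit. These are the Paley graph parameters
  scaled by \<open>m\<close>. Expanding \<open>in_Q\<close> by \<open>in_Q_eq\<close> reduces
  everything to simple sums and \<open>jacobi_sum\<close>.\<close>

lemma in_Q_convolution:
  assumes z: "z \<in> carrier R"
  shows "(\<Sum>t\<in>carrier R. in_Q t * in_Q (z \<ominus> t)) = m * (c * (1 + in_M z) - in_Q z)"
proof -
  have M_shift: "in_M (z \<ominus> t) = in_M z" if t: "t \<in> M" for t
  proof -
    have "(z \<ominus> t) \<oplus> t = z" using z M_carr[OF t] by algebra
    then have "z \<ominus> t \<in> M \<longleftrightarrow> z \<in> M"
      using t additive_subgroup.a_closed[OF is_additive_subgroup]
        additive_subgroup.a_inv_closed[OF is_additive_subgroup] by (metis minus_eq)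
    then show ?thesis by (simp add: indicator_def)
  qed
  have \<chi>_shift: "\<chi> (z \<ominus> t) = \<chi> z" if t: "t \<in> M" for t
    using character_plus_M[OF z, of "\<ominus> t"] t additive_subgroup.a_inv_closed[OF is_additive_subgroup]
    by (simp add: minus_eq)
  let ?S = "\<lambda>h. \<Sum>t\<in>carrier R. h t"
  have "4 * ?S (\<lambda>t. in_Q t * in_Q (z \<ominus> t))
    = ?S (\<lambda>t. (1 - in_M t + \<chi> t) * (1 - in_M (z \<ominus> t) + \<chi> (z \<ominus> t)))"
    unfolding sum_distrib_left using z by (intro sum.cong) (auto simp: in_Q_eq)
  also have "\<dots> = ?S (\<lambda>t. 1) - ?S (\<lambda>t. in_M (z \<ominus> t)) + ?S (\<lambda>t. \<chi> (z \<ominus> t))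
      - ?S (\<lambda>t. in_M t * (1 - in_M (z \<ominus> t) + \<chi> (z \<ominus> t)))
      + ?S \<chi> - ?S (\<lambda>t. \<chi> t * in_M (z \<ominus> t)) + ?S (\<lambda>t. \<chi> t * \<chi> (z \<ominus> t))"
    by (simp only: algebra_simps sum.distrib sum_subtractf mult_1_right mult_1_left)
  also have "?S (\<lambda>t. in_M (z \<ominus> t)) = m"
    using sum_in_M[of "\<lambda>_. 1"] by (simp add: sum_minus[OF z])
  also have "?S (\<lambda>t. \<chi> (z \<ominus> t)) = 0" by (simp add: sum_minus[OF z] sum_character)
  also have "?S (\<lambda>t. in_M t * (1 - in_M (z \<ominus> t) + \<chi> (z \<ominus> t))) = m * (1 - in_M z + \<chi> z)"
    by (simp add: sum_in_M M_shift \<chi>_shift)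
  also have "?S (\<lambda>t. \<chi> t * in_M (z \<ominus> t)) = ?S (\<lambda>t. in_M t * \<chi> (z \<ominus> t))"
  proof -
    have "?S (\<lambda>t. \<chi> t * in_M (z \<ominus> t)) = ?S (\<lambda>t. \<chi> (z \<ominus> t) * in_M (z \<ominus> (z \<ominus> t)))"
      using sum_minus[OF z, of "\<lambda>t. \<chi> t * in_M (z \<ominus> t)"] by simp
    moreover have "z \<ominus> (z \<ominus> t) = t" if "t \<in> carrier R" for t using that z by algebra
    ultimately show ?thesis by (simp add: mult.commute)
  qed
  also have "\<dots> = m * \<chi> z" by (simp add: sum_in_M \<chi>_shift)
  also have "?S (\<lambda>t. \<chi> t * \<chi> (z \<ominus> t)) = m * ((4 * c + 1) * in_M z - 1)" by (rule jacobi_sum[OF z])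
  finally show ?thesis
    by (simp add: in_Q_eq[OF z] sum_character card_carrier field_simps)
qed

section \<open>The square-sum operator over a local ring\<close>

lemma square_sum_carrier: "x \<in> carrier R \<Longrightarrow> square_sum R f x = (\<Sum>t\<in>carrier R. in_Q t * f (x \<oplus> t))"
  unfolding square_sum_def using finite_carrier Q_carr
  by (intro sum.mono_neutral_cong_left) (auto simp: indicator_def)

text \<open>Collecting pairs of steps by their sum \<open>z\<close> and using
  \<open>in_Q_convolution\<close> gives \<open>A^2 = m (c (J + E) - A)\<close>, where
  \<open>J\<close> sums over the ring and \<open>E\<close> over a coset of \<open>M\<close>.\<close>

lemma square_sum_square_sum:
  fixes f :: "'a \<Rightarrow> real"
  assumes x: "x \<in> carrier R"
  shows "square_sum R (square_sum R f) x
    = m * (c * (sum f (carrier R) + (\<Sum>n\<in>M. f (x \<oplus> n))) - square_sum R f x)"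
proof -
  have "square_sum R (square_sum R f) x
    = (\<Sum>t\<in>carrier R. \<Sum>s\<in>carrier R. in_Q t * in_Q s * f (x \<oplus> t \<oplus> s))"
    using x by (simp add: square_sum_carrier sum_distrib_left mult.assoc)
  also have "\<dots> = (\<Sum>t\<in>carrier R. \<Sum>z\<in>carrier R. in_Q t * in_Q (z \<ominus> t) * f (x \<oplus> z))"
  proof (rule sum.cong)
    fix t assume t: "t \<in> carrier R"
    have "(\<Sum>z\<in>carrier R. in_Q t * in_Q (z \<ominus> t) * f (x \<oplus> z))
      = (\<Sum>s\<in>carrier R. in_Q t * in_Q ((t \<oplus> s) \<ominus> t) * f (x \<oplus> (t \<oplus> s)))"
      by (rule sum_plus[OF t, symmetric])
    moreover have "(t \<oplus> s) \<ominus> t = s" if "s \<in> carrier R" for s using that t by algebra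
    ultimately show "(\<Sum>s\<in>carrier R. in_Q t * in_Q s * f (x \<oplus> t \<oplus> s))
      = (\<Sum>z\<in>carrier R. in_Q t * in_Q (z \<ominus> t) * f (x \<oplus> z))"
      using x t by (simp add: a_assoc)
  qed simp
  also have "\<dots> = (\<Sum>z\<in>carrier R. (\<Sum>t\<in>carrier R. in_Q t * in_Q (z \<ominus> t)) * f (x \<oplus> z))"
    by (subst sum.swap) (simp add: sum_distrib_right)
  also have "\<dots> = (\<Sum>z\<in>carrier R. m * c * f (x \<oplus> z) + m * c * (in_M z * f (x \<oplus> z)) - m * (in_Q z * f (x \<oplus> z)))"
    by (intro sum.cong) (auto simp: in_Q_convolution algebra_simps)
  also have "\<dots> = m * c * (\<Sum>z\<in>carrier R. f (x \<oplus> z)) + m * c * (\<Sum>z\<in>carrier R. in_M z * f (x \<oplus> z))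
      - m * (\<Sum>z\<in>carrier R. in_Q z * f (x \<oplus> z))"
    by (simp add: sum.distrib sum_subtractf sum_distrib_left)
  finally show ?thesis
    using x by (simp add: sum_plus sum_in_M square_sum_carrier algebra_simps)
qed

lemma sum_square_sum:
  fixes f :: "'a \<Rightarrow> real"
  shows "sum (square_sum R f) (carrier R) = 2 * c * m * sum f (carrier R)"
proof -
  have "sum (square_sum R f) (carrier R) = (\<Sum>t\<in>Q. \<Sum>x\<in>carrier R. f (t \<oplus> x))"
    unfolding square_sum_def by (subst sum.swap) (auto intro!: sum.cong simp: a_comm Q_carr)
  also have "\<dots> = (\<Sum>t\<in>Q. sum f (carrier R))"
    by (intro sum.cong refl sum_plus Q_carr)
  finally show ?thesis by (simp add: card_Q)
qed

text \<open>Translation by \<open>n\<close> permutes \<open>Q\<close> by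
  \<open>Q_plus_M\<close>.\<close>

lemma square_sum_plus_M:
  assumes x: "x \<in> carrier R" and n: "n \<in> M"
  shows "square_sum R f (x \<oplus> n) = square_sum R f x"
  unfolding square_sum_def
proof (rule sum.reindex_bij_witness[of _ "\<lambda>t. t \<oplus> \<ominus> n" "\<lambda>t. t \<oplus> n"])
  have nc: "n \<in> carrier R" "\<ominus> n \<in> M" "\<ominus> n \<in> carrier R"
    using n M_carr additive_subgroup.a_inv_closed[OF is_additive_subgroup] by auto
  fix t assume t: "t \<in> Q"
  show "t \<oplus> \<ominus> n \<in> Q" "t \<oplus> n \<in> Q" using t n nc Q_plus_M by auto
  show "t \<oplus> \<ominus> n \<oplus> n = t" "t \<oplus> n \<oplus> \<ominus> n = t"
    using nc Q_carr[OF t] by algebra+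
  show "f (x \<oplus> (t \<oplus> n)) = f (x \<oplus> n \<oplus> t)"
    using x nc Q_carr[OF t] by (simp add: a_ac)
qed

text \<open>The quadratic identity is applied to \<open>A f\<close>. That function is constant on
  cosets of \<open>M\<close>, so \<open>E\<close> acts on it as \<open>m\<close>, and
  \<open>J A = 2 m J\<close> by \<open>sum_square_sum\<close>. The result is the relation that
  \<open>grover_periodic_of_cubic\<close> asks for.\<close>

lemma square_sum_cubic:
  fixes f :: "'a \<Rightarrow> real"
  assumes x: "x \<in> carrier R" and "c = 1"
  shows "square_sum R (square_sum R (square_sum R f)) x + m * square_sum R (square_sum R f) x
    - (real m)\<^sup>2 * square_sum R f x = 2 * (real m)\<^sup>2 * sum f (carrier R)"
  using x assms(2)
  by (simp add: square_sum_square_sum[OF x, of "square_sum R f"] sum_square_sum square_sum_plus_M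
      power2_eq_square algebra_simps)

text \<open>On functions of sum zero that are constant on cosets of \<open>M\<close>, the quadratic
  identity reads \<open>(A - l) (A + m + l) = 0\<close> with \<open>l = c * m * e\<close>. Hence
  \<open>A + m + l\<close> maps them into the eigenspace of \<open>l\<close>, which is
  \<open>e / 2\<close> times the degree \<open>2 * c * m\<close>.\<close>

lemma normalized_square_eigenvalue_half:
  fixes e :: real
  assumes e: "c * e\<^sup>2 + e = 1"
  shows "normalized_square_eigenvalue R (e / 2)"
proof -
  define q where "q = real (4 * c + 1)"
  define l where "l = c * m * e"
  \<comment> \<open>A simple function of the required kind: the indicator of \<open>M\<close> less
    its mean.\<close>
  define h where "h x = in_M x - 1 / q" for x
  define f where "f x = square_sum R h x + (m + l) * h x" for x
  have q: "q > 0" by (simp add: q_def)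
  have sum_h: "sum h (carrier R) = 0"
  proof -
    have "real (card (carrier R)) = q * m" by (simp add: card_carrier q_def algebra_simps)
    then show ?thesis using sum_in_M[of "\<lambda>_. 1"] q by (simp add: h_def sum_subtractf)
  qed
  have h_plus: "h (x \<oplus> n) = h x" if "x \<in> carrier R" "n \<in> M" for x n
  proof -
    have "(x \<oplus> n) \<oplus> \<ominus> n = x" using that M_carr[OF that(2)] by algebra
    then have "x \<oplus> n \<in> M \<longleftrightarrow> x \<in> M"
      using that additive_subgroup.a_closed[OF is_additive_subgroup]
        additive_subgroup.a_inv_closed[OF is_additive_subgroup] by metis
    then show ?thesis by (simp add: h_def indicator_def)
  qed
  have l: "l * (m + l) = c * (real m)\<^sup>2"
  proof -
    have "l * (m + l) = c * (real m)\<^sup>2 * (c * e\<^sup>2 + e)" by (simp add: l_def power2_eq_square algebra_simps)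
    then show ?thesis using e by simp
  qed
  have "square_sum R f x = card Q * (e / 2) * f x" if x: "x \<in> carrier R" for x
  proof -
    have "square_sum R f x = square_sum R (square_sum R h) x + (m + l) * square_sum R h x"
      by (simp add: f_def square_sum_def sum.distrib sum_distrib_left)
    also have "\<dots> = c * (real m)\<^sup>2 * h x + l * square_sum R h x"
      using x by (simp add: square_sum_square_sum sum_h h_plus power2_eq_square algebra_simps)
    also have "\<dots> = l * f x" unfolding l[symmetric] by (simp add: f_def algebra_simps)
    finally show ?thesis by (simp add: l_def card_Q)
  qed
  \<comment> \<open>Vanishing would force \<open>c * e = - 1 / 2\<close> and so
    \<open>c * (c * e^2 + e) = - 1 / 4\<close>, although this product equals
    \<open>c > 0\<close>.\<close>
  moreover have "f \<zero> \<noteq> 0"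
  proof
    assume "f \<zero> = 0"
    have "square_sum R h \<zero> = (\<Sum>t\<in>Q. - 1 / q)"
      unfolding square_sum_def using Q_carr Q_subset_Units Units_eq
      by (intro sum.cong) (auto simp: h_def indicator_def)
    then have s: "square_sum R h \<zero> = - (2 * c * m) / q" by (simp add: card_Q)
    have h0: "h \<zero> = 4 * c / q"
      using q additive_subgroup.zero_closed[OF is_additive_subgroup] by (simp add: h_def q_def field_simps)
    have "f \<zero> = (4 * c / q) * (m * (c * e + 1 / 2))"
      unfolding f_def l_def s h0 using q by (simp add: field_simps)
    then have "(4 * c / q) * (m * (c * e + 1 / 2)) = 0" using \<open>f \<zero> = 0\<close> by simp
    then have ce: "c * e = - 1 / 2" using q c_pos m_pos by simp
    have "c * (c * e\<^sup>2 + e) = (c * e) * (c * e) + c * e" by (simp add: power2_eq_square algebra_simps)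
    also have "\<dots> = - 1 / 4" unfolding ce by simp
    finally show False using e c_pos by simp
  qed
  ultimately show ?thesis
    unfolding normalized_square_eigenvalue_def by (intro exI[of _ f] exI[of _ \<zero>]) auto
qed

end

section \<open>Isomorphisms and products\<close>

lemma unit_squares_eq: "ring R \<Longrightarrow> unit_squares R = (\<lambda>u. u \<otimes>\<^bsub>R\<^esub> u) ` Units R"
proof -
  assume "ring R"
  then interpret ring R .
  show ?thesis
    by (auto simp: unit_squares_def numeral_2_eq_2 Units_closed intro!: exI)
qed

lemma unit_squares_closed: "ring R \<Longrightarrow> unit_squares R \<subseteq> carrier R"
proof -
  assume "ring R"
  then interpret ring R .
  show ?thesis by (auto simp: unit_squares_def Units_closed)
qed

lemma ring_iso_Units:
  assumes h: "h \<in> ring_iso R S" and "ring R" "ring S"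
  shows "h ` Units R = Units S"
proof -
  interpret R: ring R by fact
  interpret S: ring S by fact
  note iso = ring_iso_memE[OF h]
  have bij: "inj_on h (carrier R)" "h ` carrier R = carrier S"
    using iso(5) by (auto simp: bij_betw_def)
  show ?thesis
  proof (intro equalityI subsetI)
    fix y assume "y \<in> h ` Units R"
    then obtain x where x: "x \<in> Units R" "y = h x" by blast
    then obtain x' where x': "x \<in> carrier R" "x' \<in> carrier R" "x' \<otimes>\<^bsub>R\<^esub> x = \<one>\<^bsub>R\<^esub>" "x \<otimes>\<^bsub>R\<^esub> x' = \<one>\<^bsub>R\<^esub>"
      unfolding Units_def by blast
    have "h x' \<otimes>\<^bsub>S\<^esub> y = \<one>\<^bsub>S\<^esub>" "y \<otimes>\<^bsub>S\<^esub> h x' = \<one>\<^bsub>S\<^esub>"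
      using x' x(2) iso(2)[of x' x] iso(2)[of x x'] iso(4) by auto
    then show "y \<in> Units S" using x' x(2) iso(1) unfolding Units_def by blast
  next
    fix y assume "y \<in> Units S"
    then obtain y' where y': "y \<in> carrier S" "y' \<in> carrier S" "y' \<otimes>\<^bsub>S\<^esub> y = \<one>\<^bsub>S\<^esub>" "y \<otimes>\<^bsub>S\<^esub> y' = \<one>\<^bsub>S\<^esub>"
      unfolding Units_def by blast
    then obtain x x' where x: "x \<in> carrier R" "y = h x" "x' \<in> carrier R" "y' = h x'"
      using bij(2) by blast
    have "x' \<otimes>\<^bsub>R\<^esub> x = \<one>\<^bsub>R\<^esub>"
      using x y' iso(2)[of x' x] iso(4) by (intro inj_onD[OF bij(1)]) auto
    moreover have "x \<otimes>\<^bsub>R\<^esub> x' = \<one>\<^bsub>R\<^esub>"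
      using x y' iso(2)[of x x'] iso(4) by (intro inj_onD[OF bij(1)]) auto
    ultimately have "x \<in> Units R" using x unfolding Units_def by blast
    then show "y \<in> h ` Units R" using x by blast
  qed
qed

lemma ring_iso_unit_squares:
  assumes h: "h \<in> ring_iso R S" and "ring R" "ring S"
  shows "h ` unit_squares R = unit_squares S"
proof -
  interpret R: ring R by fact
  have "h ` unit_squares R = (\<lambda>u. u \<otimes>\<^bsub>S\<^esub> u) ` (h ` Units R)"
    unfolding unit_squares_eq[OF assms(2)] image_image
    using ring_iso_memE(2)[OF h] by (intro image_cong) auto
  then show ?thesis
    unfolding ring_iso_Units[OF assms] unit_squares_eq[OF assms(3)] .
qed

lemma ring_iso_inj_unit_squares:
  assumes "h \<in> ring_iso R S" and "ring R"
  shows "inj_on h (unit_squares R)"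
  using ring_iso_memE(5)[OF assms(1)] unit_squares_closed[OF assms(2)]
  by (auto simp: bij_betw_def intro: inj_on_subset)

lemma square_sum_cong:
  assumes "ring R" "\<And>y. y \<in> carrier R \<Longrightarrow> f y = g y" "x \<in> carrier R"
  shows "square_sum R f x = square_sum R g x"
proof -
  interpret ring R by fact
  show ?thesis
    unfolding square_sum_def using unit_squares_closed[OF assms(1)] assms(2,3)
    by (intro sum.cong) auto
qed

lemma ring_iso_square_sum:
  assumes h: "h \<in> ring_iso R S" and "ring R" "ring S" and x: "x \<in> carrier R"
  shows "square_sum R (\<lambda>y. f (h y)) x = square_sum S f (h x)"
proof -
  have "square_sum S f (h x) = (\<Sum>t\<in>unit_squares R. f (h x \<oplus>\<^bsub>S\<^esub> h t))"
    unfolding square_sum_def ring_iso_unit_squares[OF assms(1-3), symmetric]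
    by (simp add: sum.reindex[OF ring_iso_inj_unit_squares[OF assms(1,2)]])
  also have "\<dots> = square_sum R (\<lambda>y. f (h y)) x"
    unfolding square_sum_def using x ring_iso_memE(3)[OF h] unit_squares_closed[OF assms(2)]
    by (intro sum.cong) auto
  finally show ?thesis ..
qed

lemma ring_iso_normalized_square_eigenvalue:
  assumes h: "h \<in> ring_iso R S" and "ring R" "ring S" and e: "normalized_square_eigenvalue S e"
  shows "normalized_square_eigenvalue R e"
proof -
  obtain f y where y: "y \<in> carrier S" "f y \<noteq> 0"
    and f: "\<And>y. y \<in> carrier S \<Longrightarrow> square_sum S f y = card (unit_squares S) * e * f y"
    using e unfolding normalized_square_eigenvalue_def by blast
  obtain x where x: "x \<in> carrier R" "y = h x"
    using y ring_iso_memE(5)[OF h] by (auto simp: bij_betw_def)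
  have "card (unit_squares S) = card (unit_squares R)"
    using ring_iso_inj_unit_squares[OF assms(1,2)] ring_iso_unit_squares[OF assms(1-3)] card_image by metis
  then show ?thesis
    unfolding normalized_square_eigenvalue_def
    using x y ring_iso_square_sum[OF assms(1-3), of _ f] f ring_iso_memE(1)[OF h]
    by (intro exI[of _ "\<lambda>x. f (h x)"] exI[of _ x]) auto
qed

section \<open>Direct products\<close>

lemma RDirProd_simps [simp]:
  "carrier (RDirProd R S) = carrier R \<times> carrier S"
  "(a, b) \<otimes>\<^bsub>RDirProd R S\<^esub> (a', b') = (a \<otimes>\<^bsub>R\<^esub> a', b \<otimes>\<^bsub>S\<^esub> b')"
  "(a, b) \<oplus>\<^bsub>RDirProd R S\<^esub> (a', b') = (a \<oplus>\<^bsub>R\<^esub> a', b \<oplus>\<^bsub>S\<^esub> b')"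
  "\<one>\<^bsub>RDirProd R S\<^esub> = (\<one>\<^bsub>R\<^esub>, \<one>\<^bsub>S\<^esub>)" "\<zero>\<^bsub>RDirProd R S\<^esub> = (\<zero>\<^bsub>R\<^esub>, \<zero>\<^bsub>S\<^esub>)"
  by (simp_all add: RDirProd_def DirProd_def monoid.defs)

lemma Units_RDirProd: "Units (RDirProd R S) = Units R \<times> Units S"
  unfolding Units_def by (auto, blast)

lemma unit_squares_RDirProd:
  assumes "ring R" "ring S"
  shows "unit_squares (RDirProd R S) = unit_squares R \<times> unit_squares S"
  unfolding unit_squares_eq[OF assms(1)] unit_squares_eq[OF assms(2)] unit_squares_eq[OF RDirProd_ring[OF assms]]
  by (force simp: Units_RDirProd)

text \<open>Unit squares of a product are pairs of unit squares, so the operator acts on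
  \<open>f x * g y\<close> factor by factor and the degrees multiply.\<close>

lemma normalized_square_eigenvalue_RDirProd:
  assumes "ring R" "ring S" "normalized_square_eigenvalue R d" "normalized_square_eigenvalue S e"
  shows "normalized_square_eigenvalue (RDirProd R S) (d * e)"
proof -
  obtain f x where x: "x \<in> carrier R" "f x \<noteq> 0"
    and f: "\<And>x. x \<in> carrier R \<Longrightarrow> square_sum R f x = card (unit_squares R) * d * f x"
    using assms(3) unfolding normalized_square_eigenvalue_def by blast
  obtain g y where y: "y \<in> carrier S" "g y \<noteq> 0"
    and g: "\<And>y. y \<in> carrier S \<Longrightarrow> square_sum S g y = card (unit_squares S) * e * g y"
    using assms(4) unfolding normalized_square_eigenvalue_def by blast
  let ?h = "\<lambda>(x, y). f x * g y"
  have "square_sum (RDirProd R S) ?h (x, y) = square_sum R f x * square_sum S g y" for x y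
    unfolding square_sum_def unit_squares_RDirProd[OF assms(1,2)]
    by (simp add: sum_product sum.cartesian_product) (auto intro!: sum.cong)
  then show ?thesis
    unfolding normalized_square_eigenvalue_def
    using x y f g
    by (intro exI[of _ ?h] exI[of _ "(x, y)"])
      (auto simp: unit_squares_RDirProd[OF assms(1,2)] card_cartesian_product)
qed

lemma normalized_square_eigenvalue_one: "ring R \<Longrightarrow> normalized_square_eigenvalue R 1"
proof -
  assume "ring R"
  then interpret ring R .
  show ?thesis
    unfolding normalized_square_eigenvalue_def square_sum_def
    by (intro exI[of _ "\<lambda>_. 1"] exI[of _ "\<zero>\<^bsub>R\<^esub>"]) auto
qed

lemma normalized_square_eigenvalue_RDirProd_list:
  assumes "\<And>i. i < length Rs \<Longrightarrow> ring (Rs ! i)"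
    and "\<And>i. i < length Rs \<Longrightarrow> normalized_square_eigenvalue (Rs ! i) (e i)"
  shows "normalized_square_eigenvalue (RDirProd_list Rs) (\<Prod>i<length Rs. e i)"
  using assms
proof (induction Rs arbitrary: e)
  case Nil
  have "ring (RDirProd_list [])" by (rule RDirProd_list_is_ring) simp
  then show ?case using normalized_square_eigenvalue_one by fastforce
next
  case (Cons R Rs)
  have R: "ring R" "normalized_square_eigenvalue R (e 0)"
    using Cons.prems[of 0] by auto
  have rings: "ring (Rs ! i)" if "i < length Rs" for i using Cons.prems(1)[of "Suc i"] that by auto
  have S: "ring (RDirProd_list Rs)" using rings by (rule RDirProd_list_is_ring)
  have RS: "ring (RDirProd_list (R # Rs))" using Cons.prems(1) by (rule RDirProd_list_is_ring)
  have e: "normalized_square_eigenvalue (RDirProd_list Rs) (\<Prod>i<length Rs. e (Suc i))"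
    using Cons.IH[of "\<lambda>i. e (Suc i)"] rings Cons.prems(2)[of "Suc _"] by auto
  have "normalized_square_eigenvalue (RDirProd_list (R # Rs)) (e 0 * (\<Prod>i<length Rs. e (Suc i)))"
    using normalized_square_eigenvalue_RDirProd[OF R(1) S R(2) e]
    by (rule ring_iso_normalized_square_eigenvalue[OF
          ring_iso_set_sym[OF RDirProd_ring[OF R(1) S] RDirProd_list_iso1] RS RDirProd_ring[OF R(1) S]])
  then show ?case by (simp only: list.size prod.lessThan_Suc_shift add_0_right add_Suc_right)
qed

text \<open>The form without additive inverses passes through products coordinatewise.\<close>

definition minus_one_is_square :: "('a, 'm) ring_scheme \<Rightarrow> bool" where
  "minus_one_is_square R \<longleftrightarrow> (\<exists>u\<in>carrier R. u \<otimes>\<^bsub>R\<^esub> u \<oplus>\<^bsub>R\<^esub> \<one>\<^bsub>R\<^esub> = \<zero>\<^bsub>R\<^esub>)"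

lemma ring_iso_minus_one_is_square:
  assumes h: "h \<in> ring_iso R S" and R: "ring R" and S: "ring S" and "minus_one_is_square R"
  shows "minus_one_is_square S"
proof -
  interpret R: ring R by fact
  interpret S: ring S by fact
  note iso = ring_iso_memE[OF h]
  obtain u where u: "u \<in> carrier R" "u \<otimes>\<^bsub>R\<^esub> u \<oplus>\<^bsub>R\<^esub> \<one>\<^bsub>R\<^esub> = \<zero>\<^bsub>R\<^esub>"
    using assms(4) unfolding minus_one_is_square_def by blast
  interpret H: ring_hom_ring R S h
    using h by (intro ring_hom_ringI2 R S) (simp add: ring_iso_def)
  have "h u \<otimes>\<^bsub>S\<^esub> h u \<oplus>\<^bsub>S\<^esub> \<one>\<^bsub>S\<^esub> = h (u \<otimes>\<^bsub>R\<^esub> u \<oplus>\<^bsub>R\<^esub> \<one>\<^bsub>R\<^esub>)"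
    using u(1) by simp
  also have "\<dots> = \<zero>\<^bsub>S\<^esub>" by (simp add: u(2))
  finally show ?thesis using iso(1)[OF u(1)] unfolding minus_one_is_square_def by blast
qed

lemma minus_one_is_square_RDirProd_list:
  assumes "\<And>i. i < length Rs \<Longrightarrow> ring (Rs ! i)"
    and "\<And>i. i < length Rs \<Longrightarrow> minus_one_is_square (Rs ! i)"
  shows "minus_one_is_square (RDirProd_list Rs)"
  using assms
proof (induction Rs)
  case Nil
  show ?case unfolding minus_one_is_square_def by (simp add: monoid.defs)
next
  case (Cons R Rs)
  have R: "ring R" "minus_one_is_square R"
    using Cons.prems[of 0] by auto
  have rings: "ring (Rs ! i)" if "i < length Rs" for i using Cons.prems(1)[of "Suc i"] that by auto
  have S: "ring (RDirProd_list Rs)" using rings by (rule RDirProd_list_is_ring)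
  have RS: "ring (RDirProd_list (R # Rs))" using Cons.prems(1) by (rule RDirProd_list_is_ring)
  have "minus_one_is_square (RDirProd_list Rs)"
    using Cons.IH rings Cons.prems(2)[of "Suc _"] by auto
  then have "minus_one_is_square (RDirProd R (RDirProd_list Rs))"
    using R(2) unfolding minus_one_is_square_def by auto
  then show ?case
    by (rule ring_iso_minus_one_is_square[OF RDirProd_list_iso1 RDirProd_ring[OF R(1) S] RS])
qed

section \<open>From square sums back to the Cayley graph\<close>

context cring begin

text \<open>A solution of \<open>u * u = - 1\<close> is a unit with inverse \<open>- u\<close>, so
  the negative of \<open>v * v\<close> is the square of the unit \<open>u * v\<close>.\<close>

lemma pm_unit_squares_eq:
  assumes "minus_one_is_square R" shows "pm_unit_squares R = unit_squares R"
proof -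
  obtain u where u: "u \<in> carrier R" "u \<otimes> u \<oplus> \<one> = \<zero>"
    using assms unfolding minus_one_is_square_def by blast
  have uu: "u \<otimes> u = \<ominus> \<one>" using u minus_equality[of "u \<otimes> u" \<one>] by simp
  then have "u \<otimes> (\<ominus> u) = \<one>" "(\<ominus> u) \<otimes> u = \<one>" using u(1) by (simp_all add: r_minus l_minus)
  then have uU: "u \<in> Units R" using u(1) unfolding Units_def by blast
  have "\<ominus> (v \<otimes> v) = (u \<otimes> v) \<otimes> (u \<otimes> v)" if "v \<in> Units R" for v
  proof -
    have "(u \<otimes> v) \<otimes> (u \<otimes> v) = (u \<otimes> u) \<otimes> (v \<otimes> v)" using u(1) that by (simp add: m_ac Units_closed)
    then show ?thesis using that by (simp add: uu l_minus Units_closed)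
  qed
  then have "(\<lambda>x. \<ominus> x) ` unit_squares R \<subseteq> unit_squares R"
    unfolding unit_squares_eq[OF ring_axioms] using uU by blast
  then show ?thesis unfolding pm_unit_squares_def by blast
qed

lemma quadratic_unitary_cayley_graph_neighbours:
  assumes T: "minus_one_is_square R" and ne: "\<one> \<noteq> \<zero>" and u: "u \<in> carrier R"
  shows "{w. (w, u) \<in> parcs (quadratic_unitary_cayley_graph R)} = (\<lambda>t. u \<oplus> t) ` unit_squares R"
proof (intro equalityI subsetI)
  fix w assume "w \<in> {w. (w, u) \<in> parcs (quadratic_unitary_cayley_graph R)}"
  then have w: "w \<in> carrier R" "w \<ominus> u \<in> unit_squares R"
    by (auto simp: quadratic_unitary_cayley_graph_def cayley_graph_def pm_unit_squares_eq[OF T])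
  moreover have "w = u \<oplus> (w \<ominus> u)" using w(1) u by algebra
  ultimately show "w \<in> (\<lambda>t. u \<oplus> t) ` unit_squares R" by blast
next
  fix w assume "w \<in> (\<lambda>t. u \<oplus> t) ` unit_squares R"
  then obtain t where t: "t \<in> unit_squares R" "w = u \<oplus> t" by blast
  have tc: "t \<in> carrier R" using t unit_squares_closed[OF ring_axioms] by blast
  have "t \<in> Units R" using t(1) by (auto simp: unit_squares_def intro: Units_pow_closed)
  then have "t \<noteq> \<zero>" using ne by (metis Units_l_inv_ex r_null)
  have wu: "w \<ominus> u = t" unfolding t(2) using u tc by algebra
  moreover have "w \<noteq> u" using wu \<open>t \<noteq> \<zero>\<close> u by (auto simp: r_right_minus_eq)
  ultimately show "w \<in> {w. (w, u) \<in> parcs (quadratic_unitary_cayley_graph R)}"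
    using t tc u by (auto simp: quadratic_unitary_cayley_graph_def cayley_graph_def pm_unit_squares_eq[OF T])
qed

lemma regular_quadratic_unitary_cayley_graph:
  assumes T: "minus_one_is_square R" and ne: "\<one> \<noteq> \<zero>" and fin: "finite (carrier R)"
  shows "regular_pair_graph (quadratic_unitary_cayley_graph R) (card (unit_squares R))"
proof -
  let ?G = "quadratic_unitary_cayley_graph R"
  interpret G: pair_graph ?G by (rule pair_graph_quadratic_unitary_cayley_graph[OF fin])
  show ?thesis
  proof
    fix u assume "u \<in> pverts ?G"
    then have u: "u \<in> carrier R" by (simp add: quadratic_unitary_cayley_graph_def cayley_graph_def)
    have "(u, w) \<in> parcs ?G \<longleftrightarrow> (w, u) \<in> parcs ?G" for w
      using G.arcs_symmetric by blast
    then have "{w. (u, w) \<in> parcs ?G} = (\<lambda>t. u \<oplus> t) ` unit_squares R"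
      using quadratic_unitary_cayley_graph_neighbours[OF T ne u] by simp
    moreover have "inj_on (\<lambda>t. u \<oplus> t) (unit_squares R)"
      using u unit_squares_closed[OF ring_axioms] by (intro inj_onI) (auto simp: subset_iff)
    ultimately show "card {w. (u, w) \<in> parcs ?G} = card (unit_squares R)"
      by (simp add: card_image)
  qed
qed

lemma neighbour_sum_eq:
  assumes T: "minus_one_is_square R" and ne: "\<one> \<noteq> \<zero>" and fin: "finite (carrier R)" and u: "u \<in> carrier R"
  shows "regular_pair_graph.neighbour_sum (quadratic_unitary_cayley_graph R) f u = square_sum R f u"
proof -
  interpret G: regular_pair_graph "quadratic_unitary_cayley_graph R" "card (unit_squares R)"
    by (rule regular_quadratic_unitary_cayley_graph[OF T ne fin])
  have "inj_on (\<lambda>t. u \<oplus> t) (unit_squares R)"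
    using u unit_squares_closed[OF ring_axioms] by (intro inj_onI) (auto simp: subset_iff)
  then show ?thesis
    unfolding G.neighbour_sum_def square_sum_def quadratic_unitary_cayley_graph_neighbours[OF T ne u]
    by (simp add: sum.reindex)
qed

lemma card_unit_squares_pos:
  assumes "finite (carrier R)" shows "card (unit_squares R) > 0"
proof -
  have "finite (unit_squares R)" using assms unit_squares_closed[OF ring_axioms] finite_subset by blast
  moreover have "\<one> \<in> unit_squares R"
    by (auto simp: unit_squares_eq[OF ring_axioms] intro!: image_eqI[of _ _ \<one>])
  ultimately show ?thesis by (auto simp: card_gt_0_iff)
qed

lemma grover_periodic_imp_chebyshev_eigenvalue:
  assumes T: "minus_one_is_square R" and ne: "\<one> \<noteq> \<zero>" and fin: "finite (carrier R)"
    and per: "grover_periodic (quadratic_unitary_cayley_graph R)"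
  obtains \<tau> where "\<tau> > 0" "\<And>e. normalized_square_eigenvalue R e \<Longrightarrow> dilated_chebyshev (2 * e) \<tau> = 2"
proof -
  interpret G: regular_pair_graph "quadratic_unitary_cayley_graph R" "card (unit_squares R)"
    by (rule regular_quadratic_unitary_cayley_graph[OF T ne fin])
  have verts: "pverts (quadratic_unitary_cayley_graph R) = carrier R"
    by (simp add: quadratic_unitary_cayley_graph_def cayley_graph_def)
  obtain \<tau> where "\<tau> > 0" and \<tau>: "\<And>c :: real. \<And>f :: 'a \<Rightarrow> real. \<And>u. (\<And>v. v \<in> carrier R \<Longrightarrow>
      G.neighbour_sum f v = card (unit_squares R) * c * f v) \<Longrightarrow> u \<in> carrier R \<Longrightarrow> f u \<noteq> 0
       \<Longrightarrow> dilated_chebyshev (2 * c) \<tau> = 2"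
    using G.grover_periodic_imp_chebyshev[OF per card_unit_squares_pos[OF fin]] unfolding verts by blast
  have "dilated_chebyshev (2 * e) \<tau> = 2" if e: "normalized_square_eigenvalue R e" for e
  proof -
    obtain f x where "x \<in> carrier R" "f x \<noteq> 0"
      and "\<And>x. x \<in> carrier R \<Longrightarrow> square_sum R f x = card (unit_squares R) * e * f x"
      using e unfolding normalized_square_eigenvalue_def by blast
    then show ?thesis using neighbour_sum_eq[OF T ne fin] by (intro \<tau>[of f e x]) auto
  qed
  with \<open>\<tau> > 0\<close> that show ?thesis by blast
qed

lemma grover_periodic_of_square_sum_cubic:
  assumes T: "minus_one_is_square R" and ne: "\<one> \<noteq> \<zero>" and fin: "finite (carrier R)"
    and m: "card (unit_squares R) = 2 * m"
    and cubic: "\<And>f x. x \<in> carrier R \<Longrightarrow>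
      square_sum R (square_sum R (square_sum R f)) x + m * square_sum R (square_sum R f) x
        - (real m)\<^sup>2 * square_sum R f x = 2 * (real m)\<^sup>2 * sum f (carrier R)"
  shows "grover_periodic (quadratic_unitary_cayley_graph R)"
proof -
  interpret G: regular_pair_graph "quadratic_unitary_cayley_graph R" "card (unit_squares R)"
    by (rule regular_quadratic_unitary_cayley_graph[OF T ne fin])
  have verts: "pverts (quadratic_unitary_cayley_graph R) = carrier R"
    by (simp add: quadratic_unitary_cayley_graph_def cayley_graph_def)
  note ns = neighbour_sum_eq[OF T ne fin]
  show ?thesis
  proof (rule G.grover_periodic_of_cubic[of "real m"])
    show "real m > 0" using card_unit_squares_pos[OF fin] m by simp
    fix f :: "'a \<Rightarrow> real" and u assume "u \<in> pverts (quadratic_unitary_cayley_graph R)"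
    then have u: "u \<in> carrier R" unfolding verts .
    \<comment> \<open>The two operators are known to agree only on the carrier, so iterates are
      rewritten from the inside by \<open>square_sum_cong\<close>.\<close>
    have 2: "G.neighbour_sum (G.neighbour_sum f) v = square_sum R (square_sum R f) v" if "v \<in> carrier R" for v
      using that by (simp add: ns square_sum_cong[OF ring_axioms ns])
    have 3: "G.neighbour_sum (G.neighbour_sum (G.neighbour_sum f)) u = square_sum R (square_sum R (square_sum R f)) u"
      using u by (simp add: ns square_sum_cong[OF ring_axioms 2])
    show "G.neighbour_sum (G.neighbour_sum (G.neighbour_sum f)) u + real m * G.neighbour_sum (G.neighbour_sum f) u
       - (real m)\<^sup>2 * G.neighbour_sum f u = 2 * (real m)\<^sup>2 * sum f (pverts (quadratic_unitary_cayley_graph R))"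
      using cubic[OF u, of f] by (simp only: verts 3 2[OF u] ns[OF u, of f])
  qed (simp add: m)
qed

end

section \<open>The characterization\<close>

lemma card_ZFact:
  assumes "n > 0" shows "card (carrier (ZFact (int n))) = n"
proof -
  have "carrier (ZFact (int n)) = range (ZMod (int n))"
    by (auto simp: ZFact_defs A_RCOSETS_def RCOSETS_def ZMod_def a_r_coset_def)
  also have "\<dots> = ZMod (int n) ` {0..<int n}"
  proof (intro equalityI subsetI)
    fix A assume "A \<in> range (ZMod (int n))"
    then obtain a where "A = ZMod (int n) (a mod int n)" using ZMod_mod by auto
    then show "A \<in> ZMod (int n) ` {0..<int n}" using assms by auto
  qed auto
  finally show ?thesis
    by (simp add: card_image inj_on_def ZMod_eq_mod)
qed

text \<open>The additive order of the identity divides \<open>p\<close> and is not 1, so it is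
  \<open>p\<close>. Hence the integer multiples of the identity fill the ring, and the homomorphism
  from the integers has kernel generated by \<open>p\<close>.\<close>

lemma (in ring) prime_card_iso_ZFact:
  assumes p: "prime p" and card: "card (carrier R) = p"
  shows "R \<simeq> ZFact (int p)"
proof -
  define h where "h k = add_pow R (k :: int) \<one>" for k
  have fin: "finite (carrier R)" using card p by (metis card.infinite not_prime_0)
  have "\<one> \<noteq> \<zero>"
  proof
    assume "\<one> = \<zero>"
    then have "carrier R = {\<zero>}" by (metis carrier_one_zero)
    with card p show False using prime_gt_1_nat[of p] by simp
  qed
  have ord: "add.ord \<one> = p"
  proof -
    have "add.ord \<one> dvd p"
      using add.ord_dvd_group_order[of \<one>] card by (simp add: order_def)
    moreover have "add.ord \<one> \<noteq> 1" using \<open>\<one> \<noteq> \<zero>\<close> add.ord_eq_1[of \<one>] by simp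
    ultimately show ?thesis using p by (auto simp: prime_nat_iff)
  qed
  have ker: "h k = \<zero> \<longleftrightarrow> int p dvd k" for k
    using add.int_pow_eq_id[of \<one> k] ord by (simp add: h_def)
  have "h \<in> ring_hom \<Z> R"
  proof (rule ring_hom_memI)
    fix x y :: int
    show "h x \<in> carrier R" by (simp add: h_def)
    show "h (x \<otimes>\<^bsub>\<Z>\<^esub> y) = h x \<otimes> h y"
      by (simp add: h_def add_pow_ldistr_int add_pow_rdistr_int add.int_pow_pow mult.commute)
    show "h (x \<oplus>\<^bsub>\<Z>\<^esub> y) = h x \<oplus> h y"
      by (simp add: h_def add.int_pow_mult)
  qed (simp add: h_def)
  then interpret H: ring_hom_ring \<Z> R h
    by (intro ring_hom_ringI2 int.ring_axioms ring_axioms)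
  have "inj_on h {0..<int p}"
  proof (rule inj_onI)
    fix x y assume xy: "x \<in> {0..<int p}" "y \<in> {0..<int p}" "h x = h y"
    have "h (x - y) = h x \<ominus> h y"
      by (simp add: h_def minus_eq add.int_pow_diff)
    then have "int p dvd x - y" using xy ker by (simp add: h_def r_neg minus_eq)
    then have "x mod int p = y mod int p" by (simp add: mod_eq_dvd_iff)
    then show "x = y" using xy by simp
  qed
  then have "card (h ` {0..<int p}) = card (carrier R)" by (simp add: card_image card)
  then have "h ` {0..<int p} = carrier R"
    using fin by (intro card_subset_eq) (auto simp: h_def)
  then have "h ` carrier \<Z> = carrier R" by (auto simp: h_def)
  then have "\<Z> Quot (a_kernel \<Z> R h) \<simeq> R" by (rule ring_hom_ring.FactRing_iso[OF H.ring_hom_ring_axioms])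
  moreover have "a_kernel \<Z> R h = Idl\<^bsub>\<Z>\<^esub> {int p}"
    unfolding a_kernel_def' int_Idl by (auto simp: ker dvd_def mult.commute)
  ultimately have "ZFact (int p) \<simeq> R" by (simp add: ZFact_def)
  then show ?thesis
    using ring_iso_sym[OF cring.axioms(1)[OF ZFact_is_cring]] by blast
qed

lemma ring_iso_card: "R \<simeq> S \<Longrightarrow> card (carrier R) = card (carrier S)"
  unfolding is_ring_iso_def using ring_iso_memE(5) bij_betw_same_card by blast

context finite_local_ring begin

lemma minus_one_is_square_local: "minus_one_is_square R"
proof -
  obtain u where u: "u \<in> Units R" "\<ominus> \<one> = u \<otimes> u"
    using minus_one_Q unfolding unit_squares_eq[OF ring_axioms] by blast
  then have "u \<otimes> u \<oplus> \<one> = \<zero>" by (metis l_neg one_closed)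
  then show ?thesis using u(1) unfolding minus_one_is_square_def by auto
qed

text \<open>The graph lives on a ring that is only isomorphic to the local one. Transporting
  \<open>f\<close> along \<open>h\<close> matches all three iterates and the total.\<close>

lemma square_sum_cubic_iso:
  fixes f :: "'c \<Rightarrow> real"
  assumes h: "h \<in> ring_iso S R" and S: "ring S" and "c = 1" and x: "x \<in> carrier S"
  shows "square_sum S (square_sum S (square_sum S f)) x + m * square_sum S (square_sum S f) x
    - (real m)\<^sup>2 * square_sum S f x = 2 * (real m)\<^sup>2 * sum f (carrier S)"
proof -
  note bij = ring_iso_memE(5)[OF h]
  define g where "g = (\<lambda>y. f (inv_into (carrier S) h y))"
  have f: "f y = g (h y)" if "y \<in> carrier S" for y
    using that bij by (simp add: g_def bij_betw_def)
  have 1: "square_sum S f y = square_sum R g (h y)" if "y \<in> carrier S" for y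
    using square_sum_cong[OF S f that] ring_iso_square_sum[OF h S ring_axioms that] by simp
  have 2: "square_sum S (square_sum S f) y = square_sum R (square_sum R g) (h y)" if "y \<in> carrier S" for y
    using square_sum_cong[OF S 1 that] ring_iso_square_sum[OF h S ring_axioms that] by simp
  have 3: "square_sum S (square_sum S (square_sum S f)) y = square_sum R (square_sum R (square_sum R g)) (h y)"
    if "y \<in> carrier S" for y
    using square_sum_cong[OF S 2 that] ring_iso_square_sum[OF h S ring_axioms that] by simp
  have "sum f (carrier S) = (\<Sum>y\<in>carrier S. g (h y))" by (intro sum.cong) (auto simp: f)
  also have "\<dots> = sum g (carrier R)" by (rule sum.reindex_bij_betw[OF bij])
  finally show ?thesis
    using square_sum_cubic[OF ring_iso_memE(1)[OF h x] \<open>c = 1\<close>, of g] x by (simp only: 1 2 3)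
qed

lemma card_unit_squares_iso:
  assumes "h \<in> ring_iso S R" "ring S"
  shows "card (unit_squares S) = 2 * c * m"
  using ring_iso_inj_unit_squares[OF assms] ring_iso_unit_squares[OF assms ring_axioms] card_Q card_image by metis

end

text \<open>Since \<open>y\<^sup>2 = y + c\<close>, the reciprocal \<open>e = 1 / y\<close> satisfies \<open>c * e\<^sup>2 + e = 1\<close>.\<close>
lemma (in finite_local_ring) normalized_square_eigenvalue_reciprocal:
  fixes y :: real
  assumes y: "y\<^sup>2 = y + c"
  shows "normalized_square_eigenvalue R (1 / y / 2)"
proof (rule normalized_square_eigenvalue_half)
  have "y \<noteq> 0" using y c_pos by auto
  then have "c * (1 / y)\<^sup>2 + 1 / y = (y + c) / y\<^sup>2" by (simp add: field_simps power2_eq_square)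
  then show "c * (1 / y)\<^sup>2 + 1 / y = 1" using \<open>y \<noteq> 0\<close> by (simp add: y[symmetric])
qed

lemma cong_1_mod_4: "[n = 1] (mod 4) \<Longrightarrow> n = 4 * (n div 4) + 1" for n :: nat
  unfolding cong_def by presburger

theorem theorem5p5:
  fixes R :: "('a, 'm) ring_scheme"
    and s :: nat
    and Rs :: "nat \<Rightarrow> ('b, 'n) ring_scheme"
    and M :: "nat \<Rightarrow> 'b set"
  assumes "cring R"
    and "finite (carrier R)"
    and "\<one>\<^bsub>R\<^esub> \<noteq> \<zero>\<^bsub>R\<^esub>"
    and "s \<ge> 1"
    and "R \<simeq> RDirProd_list (map Rs [1..<Suc s])"
    and "\<And>i. i \<in> {1..s} \<Longrightarrow> local_cring (Rs i)"
    and "\<And>i. i \<in> {1..s} \<Longrightarrow> finite (carrier (Rs i))"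
    and "\<And>i. i \<in> {1..s} \<Longrightarrow> maximalideal (M i) (Rs i)"
    and "\<And>i j. 1 \<le> i \<Longrightarrow> i \<le> j \<Longrightarrow> j \<le> s \<Longrightarrow>
           card (carrier (Rs i)) div card (M i) \<ge> card (carrier (Rs j)) div card (M j)"
    and "\<And>i. i \<in> {1..s} \<Longrightarrow> [card (carrier (Rs i)) div card (M i) = 1] (mod 4)"
  shows "grover_periodic (quadratic_unitary_cayley_graph R) \<longleftrightarrow>
           s = 1 \<and> (Rs 1 Quot M 1) \<simeq> ZFact 5"
proof -
  interpret R: cring R by fact
  define c where "c i = card (carrier (Rs i)) div card (M i) div 4" for i
  have loc: "finite_local_ring (Rs i) (M i) (c i)" if i: "i \<in> {1..s}" for i
  proof (intro finite_local_ring.intro finite_local_ring_axioms.intro)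
    show "cring (Rs i)" using assms(6)[OF i] by (simp add: local_cring_def)
    show "maximalideal (M i) (Rs i)" "finite (carrier (Rs i))" using assms(7,8) i by auto
    show "I = M i" if "maximalideal I (Rs i)" for I
      using that assms(6)[OF i] assms(8)[OF i] unfolding local_cring_def by blast
    show "card (carrier (Rs i)) div card (M i) = 4 * c i + 1"
      using cong_1_mod_4 assms(10)[OF i] unfolding c_def by blast
  qed
  let ?L = "map Rs [1..<Suc s]"
  have len: "length ?L = s" by simp
  have L: "?L ! j = Rs (Suc j)" "Suc j \<in> {1..s}" if "j < length ?L" for j
    using that by (simp_all del: upt_Suc add: nth_map_upt)
  have Rs_ring: "ring (Rs i)" if "i \<in> {1..s}" for i
    using assms(6)[OF that] by (simp add: local_cring_def cring.axioms(1))
  have L_rings: "ring (?L ! j)" if "j < length ?L" for j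
    using L[OF that] Rs_ring by simp
  have P: "ring (RDirProd_list ?L)" using L_rings by (rule RDirProd_list_is_ring)
  obtain \<phi> where \<phi>: "\<phi> \<in> ring_iso R (RDirProd_list ?L)"
    using assms(5) unfolding is_ring_iso_def by blast
  have "minus_one_is_square (?L ! j)" if "j < length ?L" for j
    unfolding L(1)[OF that] using finite_local_ring.minus_one_is_square_local[OF loc[OF L(2)[OF that]]] .
  with L_rings have "minus_one_is_square (RDirProd_list ?L)"
    by (rule minus_one_is_square_RDirProd_list)
  then have T: "minus_one_is_square R"
    by (rule ring_iso_minus_one_is_square[OF ring_iso_set_sym[OF R.ring_axioms \<phi>] P R.ring_axioms])
  note graph = T assms(3) assms(2)
  show ?thesis
  proof
    assume "grover_periodic (quadratic_unitary_cayley_graph R)"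
    from R.grover_periodic_imp_chebyshev_eigenvalue[OF graph this]
    obtain \<tau> where \<tau>: "\<tau> > 0"
      and cheb: "\<And>e. normalized_square_eigenvalue R e \<Longrightarrow> dilated_chebyshev (2 * e) \<tau> = 2" by blast
    \<comment> \<open>Eigenvalues may be chosen independently in the factors. The index is
      \<open>Suc j\<close> because list positions start at 0 and factors at 1.\<close>
    have product: "normalized_square_eigenvalue R (\<Prod>j<s. e (Suc j))"
      if "\<And>i. i \<in> {1..s} \<Longrightarrow> normalized_square_eigenvalue (Rs i) (e i)" for e
    proof -
      have "normalized_square_eigenvalue (RDirProd_list ?L) (\<Prod>j<length ?L. e (Suc j))"
      proof (rule normalized_square_eigenvalue_RDirProd_list[OF L_rings])
        fix j assume "j < length ?L"
        then show "normalized_square_eigenvalue (?L ! j) (e (Suc j))" using L that by metis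
      qed
      then show ?thesis
        using ring_iso_normalized_square_eigenvalue[OF \<phi> R.ring_axioms P] unfolding len by blast
    qed
    \<comment> \<open>\<open>y i\<close> and \<open>y' i\<close> are the two roots of
      \<open>y^2 = y + c i\<close>.\<close>
    define y where "y i = (1 + sqrt (4 * c i + 1)) / 2" for i
    define y' where "y' i = (1 - sqrt (4 * c i + 1)) / 2" for i
    have y: "(y i)\<^sup>2 = y i + c i" "(y' i)\<^sup>2 = y' i + c i" "y i * y' i = - c i" for i
    proof -
      define r where "r = sqrt (4 * c i + 1)"
      have r: "r * r = 4 * c i + 1" by (simp add: r_def)
      show "(y i)\<^sup>2 = y i + c i" "(y' i)\<^sup>2 = y' i + c i" "y i * y' i = - c i"
        unfolding y_def y'_def r_def[symmetric] using r by (simp_all add: power2_eq_square field_simps)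
    qed
    have c1: "c i = 1" if i: "i \<in> {1..s}" for i
    proof -
      interpret Ri: finite_local_ring "Rs i" "M i" "c i" by (rule loc[OF i])
      have "dilated_chebyshev (1 / z) \<tau> = 2" if z: "z\<^sup>2 = z + c i" for z :: real
      proof -
        \<comment> \<open>The eigenvalue \<open>1 / (2 * z)\<close> in factor \<open>i\<close> is
          combined with the trivial eigenvalue 1 elsewhere, so twice the product is
          \<open>1 / z\<close>.\<close>
        let ?e = "\<lambda>j. if j = i then 1 / z / 2 else 1"
        have "normalized_square_eigenvalue R (\<Prod>j<s. ?e (Suc j))"
          using Ri.normalized_square_eigenvalue_reciprocal[OF z] normalized_square_eigenvalue_one[OF Rs_ring]
          by (intro product) auto
        also have "(\<Prod>j<s. ?e (Suc j)) = (\<Prod>j<s. if j = i - 1 then 1 / z / 2 else 1)"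
          using i by (intro prod.cong) auto
        also have "\<dots> = 1 / z / 2" using i by (subst prod.delta) auto
        finally show ?thesis using cheb by fastforce
      qed
      then have "dilated_chebyshev (1 / y i) \<tau> = 2" "dilated_chebyshev (1 / y' i) \<tau> = 2" using y by auto
      moreover have "y i \<noteq> 0" "y' i \<noteq> 0" using y[of i] Ri.c_pos by auto
      moreover have "y i \<noteq> y' i" by (simp add: y_def y'_def)
      ultimately have "int (c i) dvd 1"
        using \<tau> y[of i] by (intro dilated_chebyshev_eq_2_imp_unit[of "y i" "1 / y i" "int (c i)" "y' i" "1 / y' i" \<tau>]) auto
      then show ?thesis by simp
    qed
    have "s = 1"
    proof (rule ccontr)
      assume "s \<noteq> 1"
      then have s: "s \<ge> 2" using assms(4) by simp
      \<comment> \<open>As \<open>c = 1\<close> in both factors, conjugate roots in the first two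
        have product \<open>- 1\<close>, which yields the eigenvalue \<open>- 1 / 4\<close>.\<close>
      let ?e = "\<lambda>j. if j = 1 then 1 / y 1 / 2 else if j = 2 then 1 / y' 2 / 2 else 1"
      have "normalized_square_eigenvalue R (\<Prod>j<s. ?e (Suc j))"
        using finite_local_ring.normalized_square_eigenvalue_reciprocal[OF loc y(1)]
          finite_local_ring.normalized_square_eigenvalue_reciprocal[OF loc y(2)]
          normalized_square_eigenvalue_one[OF Rs_ring]
        by (intro product) auto
      also have "(\<Prod>j<s. ?e (Suc j)) = (\<Prod>j\<in>{0, 1}. ?e (Suc j))"
        using s by (intro prod.mono_neutral_right) auto
      also have "\<dots> = 1 / (y 1 * y' 2) / 4" by simp
      also have "y' 2 = y' 1" using c1[of 1] c1[of 2] s by (simp add: y'_def)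
      finally have "normalized_square_eigenvalue R (- 1 / 4)" using y(3)[of 1] c1[of 1] s by simp
      then show False using cheb dilated_chebyshev_minus_half_neq_2[OF \<tau>] by fastforce
    qed
    moreover have "Rs 1 Quot M 1 \<simeq> ZFact 5"
    proof -
      interpret R1: finite_local_ring "Rs 1" "M 1" "c 1" using assms(4) by (intro loc) simp
      have "card (carrier (Rs 1 Quot M 1)) = 5" using R1.card_Quot c1[of 1] assms(4) by simp
      then show ?thesis using ring.prime_card_iso_ZFact[OF R1.quotient_is_ring, of 5] by simp
    qed
    ultimately show "s = 1 \<and> Rs 1 Quot M 1 \<simeq> ZFact 5" by blast
  next
    assume R1: "s = 1 \<and> Rs 1 Quot M 1 \<simeq> ZFact 5"
    interpret R1: finite_local_ring "Rs 1" "M 1" "c 1" using assms(4) by (intro loc) simp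
    have "card (carrier (Rs 1 Quot M 1)) = 5"
      using ring_iso_card R1 card_ZFact[of 5] by fastforce
    then have c1: "c 1 = 1" using R1.card_Quot by simp
    \<comment> \<open>For \<open>s = 1\<close> the product consists of one-element lists; removing
      the list constructor identifies \<open>R\<close> with the local ring.\<close>
    have "\<phi> \<in> ring_iso R (RDirProd_list [Rs 1])" using \<phi> R1 by simp
    then have iso: "inv_into (carrier (Rs 1)) (\<lambda>a. [a]) \<circ> \<phi> \<in> ring_iso R (Rs 1)"
      using ring_iso_set_trans ring_iso_set_sym[OF R1.ring_axioms RDirProd_list_iso3] by blast
    show "grover_periodic (quadratic_unitary_cayley_graph R)"
    proof (rule R.grover_periodic_of_square_sum_cubic[OF graph])
      \<comment> \<open>With \<open>c = 1\<close> the degree \<open>2 * c * m\<close> is twice the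
        order of \<open>M 1\<close>, which serves as the \<open>m\<close> of the cubic.\<close>
      show "card (unit_squares R) = 2 * card (M 1)"
        using R1.card_unit_squares_iso[OF iso R.ring_axioms] c1 by simp
    qed (rule R1.square_sum_cubic_iso[OF iso R.ring_axioms c1])
  qed
qed

end
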